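(* Let $0<\gamma<10^{-5}$. If $G$ is a graph of order $n$ with $e(G)>n^{2}/4$, then one of the following two conditions holds: (a) $C_{t}\subset G$ for every integer $t\in\left[3,\left\lceil (1/2+\gamma)n\right\rceil\right]$; (b) there exists a vertex $v$ of $G$ such that $G-v=H_{1}\cup H_{2}$, where $H_{1}$ and $H_{2}$ are vertex-disjoint graphs satisfying $$\left(\tfrac12-900\gamma\right)n<|H_{1}|\le|H_{2}|<\left(\tfrac12+900\gamma\right)n.$$
   Context: Graphs are finite, simple and undirected. $e(G)$ is the number of edges of $G$; $|H|$ is the order (number of vertices) of a graph $H$; $C_t$ is the cycle of length $t$, and $C_t\subset G$ means $G$ contains a (not necessarily induced) subgraph isomorphic to $C_t$. $G-v$ is $G$ with the vertex $v$ deleted. Writing $G-v=H_1\cup H_2$ with $H_1,H_2$ vertex-disjoint means that $V(G)\setminus\{v\}$ is the disjoint union of $V(H_1)$ and $V(H_2)$ and every edge of $G-v$ is an edge of $H_1$ or of $H_2$ (so no edges join $V(H_1)$ to $V(H_2)$). *)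

theory Defs
  imports Complex_Main
begin

record 'a graph =
  verts :: "'a set"
  edges :: "'a set set"

definition simple_graph :: "'a graph \<Rightarrow> bool" where
  "simple_graph G \<longleftrightarrow> finite (verts G) \<and> (\<forall>e\<in>edges G. e \<subseteq> verts G \<and> card e = 2)"

definition graph_order :: "'a graph \<Rightarrow> nat" where
  "graph_order G = card (verts G)"

definition edge_count :: "'a graph \<Rightarrow> nat" where
  "edge_count G = card (edges G)"

definition subgraph :: "'a graph \<Rightarrow> 'a graph \<Rightarrow> bool" where
  "subgraph H G \<longleftrightarrow> simple_graph H \<and> verts H \<subseteq> verts G \<and> edges H \<subseteq> edges G"

definition isomorphic :: "'a graph \<Rightarrow> 'b graph \<Rightarrow> bool" where
  "isomorphic G H \<longleftrightarrow>
     (\<exists>f. bij_betw f (verts G) (verts H) \<and> edges H = (\<lambda>e. f ` e) ` edges G)"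

definition contains_copy :: "'a graph \<Rightarrow> 'b graph \<Rightarrow> bool" where
  "contains_copy G F \<longleftrightarrow> (\<exists>H. subgraph H G \<and> isomorphic F H)"

text \<open>The cycle of length \<open>t\<close>. It is a simple graph with \<open>t\<close> edges only for \<open>t \<ge> 3\<close>.\<close>

definition cycle_graph :: "nat \<Rightarrow> nat graph" where
  "cycle_graph t = \<lparr>verts = {..<t}, edges = {{i, Suc i mod t} | i. i < t}\<rparr>"

definition delete_vertex :: "'a graph \<Rightarrow> 'a \<Rightarrow> 'a graph" where
  "delete_vertex G v = \<lparr>verts = verts G - {v}, edges = {e \<in> edges G. v \<notin> e}\<rparr>"

definition graph_union :: "'a graph \<Rightarrow> 'a graph \<Rightarrow> 'a graph" where
  "graph_union G H = \<lparr>verts = verts G \<union> verts H, edges = edges G \<union> edges H\<rparr>"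

definition vertex_disjoint :: "'a graph \<Rightarrow> 'a graph \<Rightarrow> bool" where
  "vertex_disjoint G H \<longleftrightarrow> verts G \<inter> verts H = {}"

lemma simple_graph_cycle_graph:
  assumes "t \<ge> 3"
  shows "simple_graph (cycle_graph t)"
proof -
  have "i \<noteq> Suc i mod t" if "i < t" for i
    using that assms by (cases "Suc i = t") auto
  then show ?thesis
    using assms by (auto simp: simple_graph_def cycle_graph_def card_2_iff)
qed

end

theory Submission
  imports Defs
begin

text \<open>
  Let \<open>c\<close> be the length of a longest cycle \<open>C\<close> of \<open>G\<close>. Which alternative holds depends on whether
  \<open>c\<close> reaches \<open>\<lceil>(1/2 + \<gamma>) n\<rceil>\<close>.

  If it does, every shorter length occurs as well (\<open>weakly_pancyclic\<close>). Among the vertex sets \<open>S\<close>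
  that keep more than \<open>|S|\<^sup>2/4\<close> edges and a longest cycle through more than half of \<open>S\<close>, pass to one
  from which no vertex off that cycle can be removed. Each such vertex then has degree at least
  \<open>|S|/2\<close>, and inserting into the cycle a longest path that avoids it would lengthen the cycle. So
  there is no such vertex, the cycle spans \<open>S\<close>, and Bondy's theorem on Hamiltonian graphs with more
  than \<open>|S|\<^sup>2/4\<close> edges (\<open>hamiltonian_pancyclic\<close>) provides all lengths.

  If it does not, \<open>c\<close> is squeezed: the Erdos-Gallai bound \<open>2 e \<le> c (n - 1)\<close>
  (\<open>circumference_edge_bound\<close>) gives \<open>c > (n + 1)/2\<close>, while \<open>c < (1/2 + \<gamma>) n\<close>. At most
  \<open>c (n - c)/2\<close> edges meet the complement \<open>R\<close> of \<open>C\<close> (\<open>edges_off_longest_cycle\<close>), so about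
  \<open>n\<^sup>2/8\<close> edges lie inside \<open>C\<close>, which makes \<open>C\<close> almost complete. A vertex of \<open>R\<close> with
  many neighbours on \<open>C\<close> would force their successors to be pairwise nonadjacent, hence there are
  few edges between \<open>C\<close> and \<open>R\<close>, many edges inside \<open>R\<close>, and a second long cycle in \<open>R\<close>. Two
  disjoint paths between the two cycles would close up to a cycle longer than \<open>C\<close>, because almost
  all of \<open>C\<close> can be traversed between any two of its vertices. By Menger's theorem a single vertex
  \<open>w\<close> separates the cycles. Applying the Erdos-Gallai bound on one side of \<open>w\<close> and the trivial bound
  on the other, the size \<open>x\<close> of the small side satisfies \<open>x (c - 1 - x) < \<gamma> n\<^sup>2\<close>. As \<open>x\<close> is not small,
  it is close to \<open>n/2\<close>, which is the second alternative
  (\<open>barely_long_circumference_structure\<close>).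

  Both edge counts follow by induction from a form of Dirac's theorem
  (\<open>low_degree_off_longest_cycle\<close>): without cut vertices, a longest cycle that is
  not spanning leaves out some vertex of degree at most \<open>c/2\<close>. Deleting it, or splitting the graph at a cut vertex, preserves the
  bounds.
\<close>

section \<open>Two disjoint paths between two sets\<close>

definition avoiding :: "('a \<times> 'a) set \<Rightarrow> 'a \<Rightarrow> ('a \<times> 'a) set" where
  "avoiding E w = {(u, v) \<in> E. u \<noteq> w \<and> v \<noteq> w}"

abbreviation steps :: "('a \<times> 'a) set \<Rightarrow> 'a list \<Rightarrow> bool" where
  "steps E \<equiv> successively (\<lambda>u v. (u, v) \<in> E)"

definition linking :: "('a \<times> 'a) set \<Rightarrow> 'a set \<Rightarrow> 'a set \<Rightarrow> 'a list \<Rightarrow> bool" where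
  "linking E A B P \<longleftrightarrow> P \<noteq> [] \<and> distinct P \<and> steps E P \<and> hd P \<in> A \<and> last P \<in> B"

lemma steps_mono: "steps E xs \<Longrightarrow> E \<subseteq> F \<Longrightarrow> steps F xs"
  by (erule successively_mono) auto

lemma steps_reach:
  assumes "steps E xs" "u \<in> set xs"
  shows "(hd xs, u) \<in> E\<^sup>* \<and> (u, last xs) \<in> E\<^sup>*"
  using assms
proof (induction xs arbitrary: u)
  case (Cons x xs)
  show ?case
  proof (cases "xs = []")
    case False
    then have x: "(x, hd xs) \<in> E" "steps E xs" using Cons.prems by (auto simp: successively_Cons)
    have l: "(hd xs, last xs) \<in> E\<^sup>*" using Cons.IH[OF x(2), of "last xs"] False by simp
    show ?thesis
    proof (cases "u = x")
      case True
      then show ?thesis using False converse_rtrancl_into_rtrancl[OF x(1) l] by simp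
    next
      case 1: False
      then have "u \<in> set xs" using Cons.prems by simp
      from Cons.IH[OF x(2) this] show ?thesis
        using False converse_rtrancl_into_rtrancl[OF x(1)] by simp
    qed
  qed (use Cons in auto)
qed auto

lemma steps_avoiding:
  assumes "steps E xs" "w \<notin> set xs"
  shows "steps (avoiding E w) xs"
  using assms by (induction xs rule: induct_list012) (auto simp: avoiding_def)

lemma steps_closed:
  assumes "steps E xs" "xs \<noteq> []" "hd xs \<in> X" "w \<notin> set xs"
    and "\<And>u v. u \<in> X \<Longrightarrow> (u, v) \<in> E \<Longrightarrow> v \<noteq> w \<Longrightarrow> v \<in> X"
  shows "set xs \<subseteq> X"
  using assms(1-4)
proof (induction xs)
  case (Cons x xs)
  show ?case
  proof (cases "xs = []")
    case False
    then have "(x, hd xs) \<in> E" "hd xs \<in> set xs" "steps E xs"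
      using Cons.prems by (auto simp: successively_Cons)
    then have "hd xs \<in> X" using assms(5)[of x "hd xs"] Cons.prems by auto
    then show ?thesis using Cons \<open>steps E xs\<close> False by auto
  qed (use Cons in auto)
qed auto

text \<open>Menger's theorem for two paths, by induction on the edges (after Goering). If deleting an
  edge \<open>(x, y)\<close> creates a separating vertex \<open>w\<close>, then any set separating \<open>A\<close> from \<open>{w, x}\<close>, or
  \<open>{w, y}\<close> from \<open>B\<close>, without that edge also separates \<open>A\<close> from \<open>B\<close> in the whole graph, so the
  induction hypothesis links \<open>A\<close> to \<open>{w, x}\<close> and \<open>{w, y}\<close> to \<open>B\<close> by two disjoint paths each. These
  fit together at \<open>w\<close> and along \<open>(x, y)\<close>; they cannot meet elsewhere because \<open>w\<close> separates the
  parts before it from the parts after it.\<close>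

lemma two_disjoint_paths:
  assumes "finite E"
    and "\<And>w. \<exists>a\<in>A - {w}. \<exists>b\<in>B - {w}. (a, b) \<in> (avoiding E w)\<^sup>*"
  shows "\<exists>P Q. linking E A B P \<and> linking E A B Q \<and> set P \<inter> set Q = {}"
  using assms
proof (induction arbitrary: A B rule: finite_induct)
  case empty
  have emp: "avoiding {} w = {}" for w :: 'a by (auto simp: avoiding_def)
  have 1: "\<exists>a. a \<in> A \<inter> B - {w}" for w using empty[of w] by (auto simp: emp)
  obtain a where "a \<in> A \<inter> B" using 1 by blast
  moreover obtain b where "b \<in> A \<inter> B - {a}" using 1 by blast
  ultimately show ?case
    by (intro exI[of _ "[a]"] exI[of _ "[b]"]) (auto simp: linking_def)
next
  case (insert e F)
  obtain x y where e: "e = (x, y)" by (cases e)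
  show ?case
  proof (cases "\<forall>w. \<exists>a\<in>A - {w}. \<exists>b\<in>B - {w}. (a, b) \<in> (avoiding F w)\<^sup>*")
    case True
    then obtain P Q where "linking F A B P" "linking F A B Q" "set P \<inter> set Q = {}"
      using insert.IH by blast
    then show ?thesis
      by (metis linking_def steps_mono subset_insertI)
  next
    case False
    then obtain w where w: "\<And>a b. a \<in> A - {w} \<Longrightarrow> b \<in> B - {w} \<Longrightarrow> (a, b) \<notin> (avoiding F w)\<^sup>*"
      by blast
    have xw: "x \<noteq> w" and yw: "y \<noteq> w"
    proof -
      have "x \<noteq> w \<and> y \<noteq> w"
      proof (rule ccontr)
        assume "\<not> ?thesis"
        then have "avoiding (insert e F) w = avoiding F w" by (auto simp: avoiding_def e)
        then show False using insert.prems[of w] w by auto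
      qed
      then show "x \<noteq> w" "y \<noteq> w" by auto
    qed
    have A: "\<exists>a\<in>A - {u}. \<exists>t\<in>{w, x} - {u}. (a, t) \<in> (avoiding F u)\<^sup>*" for u
    proof -
      obtain a b where ab: "a \<in> A - {u}" "b \<in> B - {u}" "(a, b) \<in> (avoiding (insert e F) u)\<^sup>*"
        using insert.prems by blast
      from ab(3) have "(\<exists>t\<in>{w, x} - {u}. (a, t) \<in> (avoiding F u)\<^sup>*) \<or>
          (a \<noteq> w \<and> b \<noteq> w \<and> (a, b) \<in> (avoiding F u)\<^sup>* \<and> (a, b) \<in> (avoiding F w)\<^sup>*)"
      proof (induction rule: rtrancl_induct)
        case base
        then show ?case using ab by (cases "a = w") auto
      next
        case (step v v')
        show ?case
        proof (cases "\<exists>t\<in>{w, x} - {u}. (a, t) \<in> (avoiding F u)\<^sup>*")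
          case False
          then have v: "a \<noteq> w" "v \<noteq> w" "(a, v) \<in> (avoiding F u)\<^sup>*" "(a, v) \<in> (avoiding F w)\<^sup>*"
            using step.IH by auto
          have "(v, v') \<noteq> e" using False v step.hyps by (auto simp: e avoiding_def)
          then have vv: "(v, v') \<in> avoiding F u" using step.hyps by (auto simp: avoiding_def)
          then have "(a, v') \<in> (avoiding F u)\<^sup>*" using v by (meson rtrancl.simps)
          moreover from this have "v' \<noteq> w" using False vv by (auto simp: avoiding_def)
          moreover have "(v, v') \<in> avoiding F w" using vv v \<open>v' \<noteq> w\<close> by (auto simp: avoiding_def)
          then have "(a, v') \<in> (avoiding F w)\<^sup>*" using v by (meson rtrancl.simps)
          ultimately show ?thesis using v by blast
        qed blast
      qed
      then show ?thesis using ab w by blast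
    qed
    have B: "\<exists>t\<in>{w, y} - {u}. \<exists>b\<in>B - {u}. (t, b) \<in> (avoiding F u)\<^sup>*" for u
    proof -
      obtain a b where ab: "a \<in> A - {u}" "b \<in> B - {u}" "(a, b) \<in> (avoiding (insert e F) u)\<^sup>*"
        using insert.prems by blast
      from ab(3) have "(\<exists>t\<in>{w, y} - {u}. (t, b) \<in> (avoiding F u)\<^sup>*) \<or>
          (b \<noteq> w \<and> a \<noteq> w \<and> (a, b) \<in> (avoiding F u)\<^sup>* \<and> (a, b) \<in> (avoiding F w)\<^sup>*)"
      proof (induction rule: converse_rtrancl_induct)
        case base
        then show ?case using ab by (cases "b = w") auto
      next
        case (step v' v)
        show ?case
        proof (cases "\<exists>t\<in>{w, y} - {u}. (t, b) \<in> (avoiding F u)\<^sup>*")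
          case False
          then have v: "b \<noteq> w" "v \<noteq> w" "(v, b) \<in> (avoiding F u)\<^sup>*" "(v, b) \<in> (avoiding F w)\<^sup>*"
            using step.IH by auto
          have "(v', v) \<noteq> e" using False v step.hyps by (auto simp: e avoiding_def)
          then have vv: "(v', v) \<in> avoiding F u" using step.hyps by (auto simp: avoiding_def)
          then have "(v', b) \<in> (avoiding F u)\<^sup>*" using v by (meson converse_rtrancl_into_rtrancl)
          moreover from this have "v' \<noteq> w" using False vv by (auto simp: avoiding_def)
          moreover have "(v', v) \<in> avoiding F w" using vv v \<open>v' \<noteq> w\<close> by (auto simp: avoiding_def)
          then have "(v', b) \<in> (avoiding F w)\<^sup>*" using v by (meson converse_rtrancl_into_rtrancl)
          ultimately show ?thesis using v by blast
        qed blast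
      qed
      then show ?thesis using ab w by blast
    qed
    obtain P P' where PP: "linking F A {w, x} P" "linking F A {w, x} P'" "set P \<inter> set P' = {}"
      using insert.IH[OF A] by blast
    obtain Q Q' where QQ: "linking F {w, y} B Q" "linking F {w, y} B Q'" "set Q \<inter> set Q' = {}"
      using insert.IH[OF B] by blast
    have "last P \<noteq> last P'" using PP by (metis disjoint_iff last_in_set linking_def)
    then obtain Pw Px where P: "linking F A {w} Pw" "linking F A {x} Px" "set Pw \<inter> set Px = {}"
      using PP unfolding linking_def by (metis Int_commute insert_iff singletonD)
    have "hd Q \<noteq> hd Q'" using QQ by (metis disjoint_iff hd_in_set linking_def)
    then obtain Qw Qy where Q: "linking F {w} B Qw" "linking F {y} B Qy" "set Qw \<inter> set Qy = {}"
      using QQ unfolding linking_def by (metis Int_commute insert_iff singletonD)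
    define RA where "RA = {u. \<exists>a\<in>A - {w}. (a, u) \<in> (avoiding F w)\<^sup>*}"
    define RB where "RB = {u. \<exists>b\<in>B - {w}. (u, b) \<in> (avoiding F w)\<^sup>*}"
    have RAB: "RA \<inter> RB = {}" using w unfolding RA_def RB_def
      by (blast intro: rtrancl_trans[of _ _ "avoiding F w"])
    obtain Pb where Pb: "Pw = Pb @ [w]" using P(1) unfolding linking_def
      by (metis append_butlast_last_id singletonD)
    obtain Qb where Qb: "Qw = w # Qb" using Q(1) unfolding linking_def
      by (metis list.collapse singletonD)
    have reachA: "set xs \<subseteq> RA" if "steps F xs" "w \<notin> set xs" "xs \<noteq> [] \<Longrightarrow> hd xs \<in> A" for xs
    proof
      fix u assume u: "u \<in> set xs"
      then have "hd xs \<in> A - {w}" using that by (metis Diff_iff empty_iff empty_set hd_in_set singletonD)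
      then show "u \<in> RA" using steps_reach[OF steps_avoiding[OF that(1,2)] u] unfolding RA_def by blast
    qed
    have reachB: "set xs \<subseteq> RB" if "steps F xs" "w \<notin> set xs" "xs \<noteq> [] \<Longrightarrow> last xs \<in> B" for xs
    proof
      fix u assume u: "u \<in> set xs"
      then have "last xs \<in> B - {w}" using that by (metis Diff_iff empty_iff empty_set last_in_set singletonD)
      then show "u \<in> RB" using steps_reach[OF steps_avoiding[OF that(1,2)] u] unfolding RB_def by blast
    qed
    have "set Pb \<subseteq> RA" using P(1) unfolding Pb linking_def
      by (intro reachA) (auto simp: successively_append_iff)
    moreover have "set Px \<subseteq> RA" using P unfolding Pb linking_def by (intro reachA) auto
    moreover have "set Qb \<subseteq> RB" using Q(1) unfolding Qb linking_def
      by (intro reachB) (auto simp: successively_Cons)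
    moreover have "set Qy \<subseteq> RB" using Q unfolding Qb linking_def by (intro reachB) auto
    ultimately have dis: "set Pb \<inter> set Qb = {}" "set Pb \<inter> set Qy = {}" "set Px \<inter> set Qb = {}"
        "set Px \<inter> set Qy = {}"
      using RAB by blast+
    have "linking (insert e F) A B (Pb @ w # Qb)"
    proof -
      have "steps F (Pb @ w # Qb)" using P(1) Q(1) unfolding Pb Qb linking_def
        by (auto simp: successively_append_iff successively_Cons)
      then have "steps (insert e F) (Pb @ w # Qb)" by (rule steps_mono) auto
      then show ?thesis using P(1) Q(1) dis unfolding Pb Qb linking_def
        by (auto simp: hd_append)
    qed
    moreover have "linking (insert e F) A B (Px @ Qy)"
    proof -
      have "steps (insert e F) Px" "steps (insert e F) Qy"
        using P(2) Q(2) steps_mono[OF _ subset_insertI[of F e]]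
        unfolding linking_def by auto
      then show ?thesis using P(2) Q(2) dis unfolding linking_def
        by (auto simp: successively_append_iff e)
    qed
    moreover have "set (Pb @ w # Qb) \<inter> set (Px @ Qy) = {}"
      using dis P(3) Q(3) unfolding Pb Qb by auto
    ultimately show ?thesis by blast
  qed
qed

text \<open>The piece from the last visit to \<open>A\<close> to the first visit to \<open>B\<close> after it.\<close>

lemma linking_trim:
  assumes "linking E A B xs"
  shows "\<exists>ys. linking E A B ys \<and> set ys \<subseteq> set xs \<and> set ys \<inter> A = {hd ys} \<and> set ys \<inter> B = {last ys}"
proof -
  have "\<exists>x\<in>set xs. x \<in> A" using assms by (auto simp: linking_def)
  then obtain us a vs where a: "xs = us @ a # vs" "a \<in> A" "\<forall>z\<in>set vs. z \<notin> A"
    by (rule split_list_last_propE)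
  have "\<exists>x\<in>set (a # vs). x \<in> B" using assms a unfolding linking_def
    by (metis last_appendR last_in_set list.distinct(1))
  then obtain ps b qs where b: "a # vs = ps @ b # qs" "b \<in> B" "\<forall>z\<in>set ps. z \<notin> B"
    by (rule split_list_first_propE)
  have h: "hd (ps @ [b]) = a" using b(1) by (cases ps) auto
  have xs: "xs = us @ (ps @ [b]) @ qs" using a b by simp
  have "set (tl (ps @ [b])) \<subseteq> set vs" using b(1) by (cases ps) auto
  then have "set (ps @ [b]) \<inter> A = {a}" using a(2,3) h
    by (cases "ps @ [b]") auto
  moreover have "linking E A B (ps @ [b])" 
    using assms a(2) b(2) h unfolding linking_def xs by (auto simp: successively_append_iff hd_append)
  ultimately show ?thesis using b h xs by (intro exI[of _ "ps @ [b]"]) auto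
qed

text \<open>The failing case is stated as a set \<open>X\<close> that is closed under steps other than those into \<open>w\<close>;
  it is the part reachable from \<open>A\<close> once \<open>w\<close> is removed. Since \<open>w\<close> ranges over the whole type, it may
  lie outside the graph, in which case nothing at all leaves \<open>X\<close>.\<close>

lemma menger_two:
  assumes "finite E"
  obtains (paths) P Q where "linking E A B P" "linking E A B Q" "set P \<inter> set Q = {}"
      "set P \<inter> A = {hd P}" "set Q \<inter> A = {hd Q}" "set P \<inter> B = {last P}" "set Q \<inter> B = {last Q}"
  | (separator) w X where "w \<notin> X" "A \<subseteq> insert w X" "X \<inter> B = {}" "X \<subseteq> A \<union> Range E"
      "\<And>u v. u \<in> X \<Longrightarrow> (u, v) \<in> E \<Longrightarrow> v \<noteq> w \<Longrightarrow> v \<in> X"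
proof (cases "\<forall>w. \<exists>a\<in>A - {w}. \<exists>b\<in>B - {w}. (a, b) \<in> (avoiding E w)\<^sup>*")
  case True
  then obtain P0 Q0 where P0: "linking E A B P0" "linking E A B Q0" "set P0 \<inter> set Q0 = {}"
    using two_disjoint_paths[OF assms, of A B] by blast
  obtain P where "linking E A B P" "set P \<subseteq> set P0" "set P \<inter> A = {hd P}" "set P \<inter> B = {last P}"
    using linking_trim[OF P0(1)] by blast
  moreover obtain Q where "linking E A B Q" "set Q \<subseteq> set Q0" "set Q \<inter> A = {hd Q}" "set Q \<inter> B = {last Q}"
    using linking_trim[OF P0(2)] by blast
  ultimately show ?thesis using P0 by (intro paths[of P Q]) auto
next
  case False
  then obtain w where w: "\<And>a b. a \<in> A - {w} \<Longrightarrow> b \<in> B - {w} \<Longrightarrow> (a, b) \<notin> (avoiding E w)\<^sup>*"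
    by blast
  define X where "X = (avoiding E w)\<^sup>* `` (A - {w})"
  have X1: "u \<noteq> w \<and> u \<in> A \<union> Range E" if "u \<in> X" for u
  proof -
    obtain a where "a \<in> A - {w}" "(a, u) \<in> (avoiding E w)\<^sup>*" using \<open>u \<in> X\<close> X_def by auto
    from this(2,1) show ?thesis by (cases rule: rtrancl.cases) (auto simp: avoiding_def)
  qed
  show ?thesis
  proof (rule separator[of w X])
    show "w \<notin> X" "X \<subseteq> A \<union> Range E" using X1 by auto
    show "A \<subseteq> insert w X" by (auto simp: X_def)
    show "X \<inter> B = {}" using w X1 unfolding X_def by blast
    show "v \<in> X" if uv: "u \<in> X" "(u, v) \<in> E" "v \<noteq> w" for u v
    proof -
      have "(u, v) \<in> avoiding E w" using uv X1 by (auto simp: avoiding_def)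
      moreover obtain a where "a \<in> A - {w}" "(a, u) \<in> (avoiding E w)\<^sup>*"
        using uv(1) unfolding X_def by blast
      ultimately show ?thesis unfolding X_def by (meson ImageI rtrancl.rtrancl_into_rtrancl)
    qed
  qed
qed

section \<open>Edge sets, degrees and separations\<close>

text \<open>All subgraphs in the argument are induced. One edge set is fixed, and a subgraph is given by its
  vertex set.\<close>

locale finite_edges =
  fixes E :: "'a set set"
  assumes finite_E: "finite E" and card_edge: "e \<in> E \<Longrightarrow> card e = 2"
begin

definition adj :: "'a \<Rightarrow> 'a \<Rightarrow> bool" where "adj u v \<longleftrightarrow> {u, v} \<in> E"

definition nbrs :: "'a set \<Rightarrow> 'a \<Rightarrow> 'a set" where "nbrs S v = {u \<in> S. adj v u}"

definition ecount :: "'a set \<Rightarrow> nat" where "ecount S = card {e \<in> E. e \<subseteq> S}"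

definition path :: "'a list \<Rightarrow> bool" where
  "path xs \<longleftrightarrow> distinct xs \<and> successively adj xs"

definition cycle :: "'a list \<Rightarrow> bool" where
  "cycle xs \<longleftrightarrow> 3 \<le> length xs \<and> path xs \<and> adj (last xs) (hd xs)"

lemma adj_sym: "adj u v \<Longrightarrow> adj v u"
  by (simp add: adj_def insert_commute)

lemma adj_commute: "adj u v \<longleftrightarrow> adj v u"
  using adj_sym by blast

lemma adj_irrefl: "\<not> adj u u"
  using card_edge[of "{u, u}"] by (auto simp: adj_def)

lemma adj_neq: "adj u v \<Longrightarrow> u \<noteq> v"
  using adj_irrefl by auto

lemma finite_nbrs: "finite S \<Longrightarrow> finite (nbrs S v)"
  by (simp add: nbrs_def)

lemma edgeE:
  assumes "e \<in> E" obtains u v where "e = {u, v}" "u \<noteq> v" "adj u v"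
  using card_edge[OF assms] assms by (auto simp: card_2_iff adj_def)

lemma ecount_remove:
  assumes "v \<in> S"
  shows "ecount S = ecount (S - {v}) + card (nbrs S v)"
proof -
  have "{e \<in> E. e \<subseteq> S} = {e \<in> E. e \<subseteq> S - {v}} \<union> (\<lambda>u. {v, u}) ` nbrs S v"
    (is "?L = ?M \<union> ?N")
  proof (intro equalityI subsetI)
    fix e assume e: "e \<in> ?L"
    then obtain a b where "e = {a, b}" "a \<noteq> b" "adj a b" by (auto elim: edgeE)
    with e show "e \<in> ?M \<union> ?N" using adj_sym by (auto simp: nbrs_def)
  qed (use assms in \<open>auto simp: nbrs_def adj_def\<close>)
  moreover have "?M \<inter> ?N = {}" by auto
  moreover have "card ?N = card (nbrs S v)"
    by (rule card_image) (auto simp: inj_on_def doubleton_eq_iff)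
  moreover have "finite ?L" using finite_E by simp
  ultimately show ?thesis
    unfolding ecount_def using card_Un_disjoint[of ?M ?N] by (metis (no_types, lifting) finite_Un)
qed

lemma handshake: "finite S \<Longrightarrow> (\<Sum>v\<in>S. card (nbrs S v)) = 2 * ecount S"
proof (induction S rule: finite_induct)
  case empty
  have "{e \<in> E. e \<subseteq> {}} = {}" using card_edge by fastforce
  then show ?case by (simp add: ecount_def del: subset_empty)
next
  case (insert v S)
  have eq: "nbrs (insert v S) v = nbrs S v" using adj_irrefl by (auto simp: nbrs_def)
  have "card (nbrs (insert v S) u) = card (nbrs S u) + (if u \<in> nbrs S v then 1 else 0)"
    if "u \<in> S" for u
  proof -
    have "nbrs (insert v S) u = (if adj v u then insert v (nbrs S u) else nbrs S u)"
      using adj_commute by (auto simp: nbrs_def)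
    then show ?thesis using insert.hyps that by (simp add: nbrs_def)
  qed
  then have "(\<Sum>u\<in>S. card (nbrs (insert v S) u)) = 2 * ecount S + (\<Sum>u\<in>S. if u \<in> nbrs S v then 1 else 0)"
    using insert.IH by (simp add: sum.distrib)
  also have "(\<Sum>u\<in>S. if u \<in> nbrs S v then 1 else 0) = card (nbrs S v)"
    using insert.hyps by (simp add: sum.If_cases nbrs_def Int_def)
  finally show ?case
    using insert.hyps ecount_remove[of v "insert v S"] eq by simp
qed

lemma ecount_le:
  assumes "finite S"
  shows "2 * ecount S \<le> card S * (card S - 1)"
proof -
  have "card (nbrs S v) \<le> card S - 1" if "v \<in> S" for v
  proof -
    have "nbrs S v \<subseteq> S - {v}" using adj_irrefl by (auto simp: nbrs_def)
    then show ?thesis using assms that by (metis card_Diff_singleton card_mono finite_Diff)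
  qed
  then have "(\<Sum>v\<in>S. card (nbrs S v)) \<le> card S * (card S - 1)"
    using sum_bounded_above[of S "\<lambda>v. card (nbrs S v)" "card S - 1"] by simp
  then show ?thesis using handshake[OF assms] by simp
qed

lemma ecount_missing:
  assumes "finite S" "finite F" "F \<subseteq> {e. e \<subseteq> S \<and> card e = 2}" "F \<inter> E = {}"
  shows "2 * ecount S + 2 * card F \<le> card S * (card S - 1)"
proof -
  have "ecount S + card F = card ({e \<in> E. e \<subseteq> S} \<union> F)"
    unfolding ecount_def using assms finite_E by (intro card_Un_disjoint[symmetric]) auto
  also have "\<dots> \<le> card {e. e \<subseteq> S \<and> card e = 2}"
    using assms card_edge by (intro card_mono) auto
  also have "\<dots> = card S choose 2" by (rule n_subsets[OF assms(1)])
  finally have "2 * (ecount S + card F) \<le> 2 * (card S choose 2)" by (rule mult_le_mono2)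
  also have "2 * (card S choose 2) = card S * (card S - 1)" unfolding choose_two
    by (cases "card S") auto
  finally show ?thesis unfolding distrib_left .
qed

text \<open>A cut vertex \<open>w\<close> of the graph induced on \<open>S\<close>, with the two sides both containing \<open>w\<close>. A disconnected
  graph on at least three vertices also has a separation, so the absence of separations means
  2-connectedness, except on at most two vertices.\<close>

definition separation :: "'a set \<Rightarrow> 'a set \<Rightarrow> 'a set \<Rightarrow> 'a \<Rightarrow> bool" where
  "separation S V W w \<longleftrightarrow> V \<union> W = S \<and> V \<inter> W = {w} \<and> V \<noteq> {w} \<and> W \<noteq> {w} \<and>
     (\<forall>u\<in>V - {w}. \<forall>v\<in>W - {w}. \<not> adj u v)"

lemma separation_sym: "separation S V W w \<Longrightarrow> separation S W V w"
  unfolding separation_def using adj_sym by blast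

lemma separation_subset: "separation S V W w \<Longrightarrow> V \<subset> S \<and> W \<subset> S"
  unfolding separation_def by blast

lemma separation_card:
  assumes "separation S V W w" "finite S"
  shows "card V + card W = card S + 1"
proof -
  have "finite V" "finite W" using assms unfolding separation_def by auto
  then show ?thesis
    using card_Un_Int[of V W] assms unfolding separation_def by simp
qed

lemma separation_ecount:
  assumes "separation S V W w"
  shows "ecount S \<le> ecount V + ecount W"
proof -
  have "{e \<in> E. e \<subseteq> S} \<subseteq> {e \<in> E. e \<subseteq> V} \<union> {e \<in> E. e \<subseteq> W}"
  proof
    fix e assume e: "e \<in> {e \<in> E. e \<subseteq> S}"
    then obtain a b where "e = {a, b}" "a \<noteq> b" "adj a b" by (auto elim: edgeE)
    then show "e \<in> {e \<in> E. e \<subseteq> V} \<union> {e \<in> E. e \<subseteq> W}"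
      using e assms adj_sym unfolding separation_def by blast
  qed
  then have "card {e \<in> E. e \<subseteq> S} \<le> card ({e \<in> E. e \<subseteq> V} \<union> {e \<in> E. e \<subseteq> W})"
    using finite_E by (intro card_mono) auto
  then show ?thesis unfolding ecount_def by (rule order_trans[OF _ card_Un_le])
qed

section \<open>Paths and cycles as lists\<close>

lemma adj_flip: "(\<lambda>x y. adj y x) = adj"
  by (intro ext) (rule adj_commute)

lemma path_rev: "path (rev xs) \<longleftrightarrow> path xs"
  unfolding path_def successively_rev adj_flip distinct_rev ..

lemma path_append:
  "path (xs @ ys) \<longleftrightarrow> path xs \<and> path ys \<and> set xs \<inter> set ys = {} \<and>
     (xs = [] \<or> ys = [] \<or> adj (last xs) (hd ys))"
  by (auto simp: path_def successively_append_iff)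

lemma path_Nil [simp]: "path []" and path_single [simp]: "path [x]"
  by (auto simp: path_def)

lemma path_Cons: "path (x # xs) \<longleftrightarrow> path xs \<and> x \<notin> set xs \<and> (xs = [] \<or> adj x (hd xs))"
  by (cases xs) (auto simp: path_def)

lemma path_take: "path xs \<Longrightarrow> path (take k xs)"
  by (metis append_take_drop_id path_append)

lemma path_drop: "path xs \<Longrightarrow> path (drop k xs)"
  by (metis append_take_drop_id path_append)

lemma cycle_swap: "cycle (xs @ ys) \<Longrightarrow> cycle (ys @ xs)"
  by (cases "xs = []"; cases "ys = []") (auto simp: cycle_def path_append)

lemma cycle_rotate: "cycle xs \<Longrightarrow> cycle (rotate k xs)"
  by (metis append_take_drop_id cycle_swap rotate_drop_take)

lemma cycle_distinct: "cycle xs \<Longrightarrow> distinct xs"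
  by (simp add: cycle_def path_def)

lemma cycle_card: "cycle xs \<Longrightarrow> card (set xs) = length xs"
  by (simp add: cycle_distinct distinct_card)

lemma cycle_hd_at:
  assumes "cycle zs" "z \<in> set zs"
  obtains ws where "cycle ws" "set ws = set zs" "length ws = length zs" "hd ws = z"
proof -
  obtain us vs where "zs = us @ z # vs" using assms(2) by (meson split_list)
  then show ?thesis using cycle_swap[of us "z # vs"] assms(1) by (intro that[of "(z # vs) @ us"]) auto
qed

text \<open>An outside path attached to the first vertex and to the vertex at position \<open>j\<close> of a cycle
  replaces the \<open>j - 1\<close> vertices in between. For a longest cycle the path has therefore fewer than
  \<open>j\<close> vertices.\<close>

lemma cycle_detour:
  assumes "cycle ws" "path xs" "xs \<noteq> []" "set xs \<inter> set ws = {}"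
    and "0 < j" "j < length ws" "adj (hd ws) (hd xs)" "adj (last xs) (ws ! j)"
  shows "cycle (hd ws # xs @ drop j ws)"
proof -
  obtain w us where ws: "ws = w # us" using assms(1) by (cases ws) (auto simp: cycle_def)
  have d: "drop j ws \<noteq> []" "hd (drop j ws) = ws ! j" "last (drop j ws) = last ws"
    using assms(6) by (auto simp: hd_drop_conv_nth)
  have p: "path (drop j ws)" using assms(1) by (auto simp: cycle_def path_drop)
  have "set (drop j ws) \<subseteq> set us" using \<open>0 < j\<close> by (cases j) (auto simp: ws dest: in_set_dropD)
  moreover have "w \<notin> set us" using assms(1) by (auto simp: ws cycle_def path_def)
  ultimately have w: "w \<notin> set (drop j ws)" by auto
  have s: "set xs \<inter> set (drop j ws) = {}" using assms(4) by (auto dest: in_set_dropD)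
  have "w \<notin> set xs" using assms(4) ws by auto
  then have "path (w # xs @ drop j ws)"
    using p assms d w s unfolding path_Cons path_append by (auto simp: ws)
  moreover have "3 \<le> length (w # xs @ drop j ws)"
    using d(1) assms(3) by (cases xs; cases "drop j ws") auto
  moreover have "adj (last (w # xs @ drop j ws)) w"
    using d assms(1) unfolding cycle_def ws by auto
  ultimately show ?thesis unfolding cycle_def ws by simp
qed

lemma longest_list_exists:
  assumes "finite S" "P xs0" "\<And>xs. P xs \<Longrightarrow> distinct xs \<and> set xs \<subseteq> S"
  obtains xs where "P xs" "\<And>ys. P ys \<Longrightarrow> length ys \<le> length xs"
proof -
  have "length y \<le> card S" if "P y" for y
    using assms(3)[OF that] card_mono[of S "set y"] assms(1) distinct_card[of y] by auto
  then have "\<forall>y. P y \<longrightarrow> length y < Suc (card S)" by (simp add: less_Suc_eq_le)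
  from ex_has_greatest_nat[OF assms(2) this] show ?thesis using that by blast
qed

text \<open>The first vertex of a longest path has all its neighbours on the path, and one of them is not
  the second vertex.\<close>

lemma cycle_if_min_degree_two:
  assumes "finite S" "S \<noteq> {}" "\<And>v. v \<in> S \<Longrightarrow> 2 \<le> card (nbrs S v)"
  shows "\<exists>xs. cycle xs \<and> set xs \<subseteq> S"
proof -
  obtain s where s: "s \<in> S" using assms(2) by blast
  obtain xs where xs: "path xs \<and> set xs \<subseteq> S \<and> xs \<noteq> []"
      and long: "\<And>ys. path ys \<and> set ys \<subseteq> S \<and> ys \<noteq> [] \<Longrightarrow> length ys \<le> length xs"
    by (rule longest_list_exists[of S "\<lambda>xs. path xs \<and> set xs \<subseteq> S \<and> xs \<noteq> []" "[s]"])
      (use s assms(1) in \<open>auto simp: path_def\<close>)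
  have nb: "nbrs S (hd xs) \<subseteq> set (tl xs)"
  proof
    fix u assume u: "u \<in> nbrs S (hd xs)"
    then have "u \<in> set xs"
      using long[of "u # xs"] xs by (auto simp: nbrs_def path_Cons adj_commute)
    moreover have "u \<noteq> hd xs" using u adj_irrefl by (auto simp: nbrs_def)
    ultimately show "u \<in> set (tl xs)" by (cases xs) auto
  qed
  have "hd xs \<in> S" using xs by (meson hd_in_set subsetD)
  then have "card (nbrs S (hd xs)) \<ge> 2" using assms by blast
  then have "\<not> nbrs S (hd xs) \<subseteq> {xs ! 1}"
    using card_mono[of "{xs ! 1}" "nbrs S (hd xs)"] by auto
  then obtain u where u: "u \<in> nbrs S (hd xs)" "u \<noteq> xs ! 1" by blast
  then obtain i where i: "i < length xs" "u = xs ! i" "i \<noteq> 0"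
  proof -
    have "u \<in> set (tl xs)" using u nb by blast
    then obtain k where "k < length (tl xs)" "u = tl xs ! k" by (metis in_set_conv_nth)
    then show ?thesis using that[of "Suc k"] by (simp add: nth_tl)
  qed
  have "i \<noteq> 1" using i u by auto
  moreover have "path (take (Suc i) xs)" using xs path_take by blast
  ultimately have "cycle (take (Suc i) xs)"
    using i u xs unfolding cycle_def
    by (auto simp: take_Suc_conv_app_nth nbrs_def adj_commute hd_append)
  then show ?thesis using xs set_take_subset[of "Suc i" xs] by blast
qed

lemma cycle_arcs:
  assumes "cycle zs" "x \<in> set zs" "y \<in> set zs" "x \<noteq> y"
  obtains us vs where "path (x # us @ [y])" "path (x # vs @ [y])"
    "set us \<inter> set vs = {}" "set us \<union> set vs = set zs - {x, y}"
    "length zs = length us + length vs + 2"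
proof -
  obtain ws where ws: "cycle ws" "set ws = set zs" "length ws = length zs" "hd ws = x"
    using cycle_hd_at[OF assms(1,2)] .
  obtain us vs where uv: "tl ws = us @ y # vs"
    using assms(3,4) ws by (metis list.exhaust_sel list.sel(2) set_ConsD split_list)
  have w: "ws = x # us @ y # vs" using ws uv by (metis cycle_def list.exhaust_sel list.size(3) not_numeral_le_zero)
  have c: "path (x # us @ y # vs)" "adj (last (y # vs)) x"
    using ws(1) unfolding w cycle_def by auto
  have "path (x # us @ [y])" using c unfolding path_Cons path_append
    by (auto simp: hd_append)
  moreover have "path (x # rev vs @ [y])"
  proof -
    have "path (y # vs @ [x])" using c unfolding path_Cons path_append by (auto simp: hd_append)
    then have "path (rev (y # vs @ [x]))" by (simp only: path_rev)
    then show ?thesis by simp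
  qed
  moreover have "set us \<inter> set (rev vs) = {}" "set us \<union> set (rev vs) = set zs - {x, y}"
    using cycle_distinct[OF ws(1)] ws(2)[symmetric] unfolding w by auto
  ultimately show ?thesis using that[of us "rev vs"] ws(3) unfolding w by simp
qed

lemma cycle_long_arc:
  assumes "cycle zs" "x \<in> set zs" "y \<in> set zs" "x \<noteq> y"
  obtains us where "path (x # us @ [y])" "set us \<subseteq> set zs - {x, y}" "length zs \<le> 2 * length us + 2"
proof -
  obtain us vs where u: "path (x # us @ [y])" "path (x # vs @ [y])"
    "set us \<inter> set vs = {}" "set us \<union> set vs = set zs - {x, y}"
    "length zs = length us + length vs + 2"
    by (rule cycle_arcs[OF assms])
  show ?thesis
  proof (cases "length us \<le> length vs")
    case True
    then show ?thesis using u(2,4,5) by (intro that[of vs]) auto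
  next
    case False
    then show ?thesis using u(1,4,5) by (intro that[of us]) auto
  qed
qed

lemma cycle_path_avoiding:
  assumes "cycle zs" "x \<in> set zs" "y \<in> set zs" "x \<noteq> y" "x \<noteq> w" "y \<noteq> w"
  obtains us where "path (x # us @ [y])" "set us \<subseteq> set zs" "w \<notin> set us"
proof -
  obtain us vs where u: "path (x # us @ [y])" "path (x # vs @ [y])"
    "set us \<inter> set vs = {}" "set us \<union> set vs = set zs - {x, y}"
    by (rule cycle_arcs[OF assms(1-4)])
  show ?thesis
  proof (cases "w \<in> set us")
    case True
    then show ?thesis using u(2,3,4) by (intro that[of vs]) auto
  next
    case False
    then show ?thesis using u(1,4) by (intro that[of us]) auto
  qed
qed

section \<open>Vertices off a longest cycle\<close>

lemma nbrs_card_le_positions: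
  assumes "set ws \<subseteq> C" "C \<subseteq> set ws"
  shows "card (nbrs C x) \<le> card {i. i < length ws \<and> adj x (ws ! i)}"
proof -
  have "nbrs C x \<subseteq> (\<lambda>i. ws ! i) ` {i. i < length ws \<and> adj x (ws ! i)}"
  proof
    fix u assume "u \<in> nbrs C x"
    then have "u \<in> set ws" "adj x u" using assms by (auto simp: nbrs_def)
    then show "u \<in> (\<lambda>i. ws ! i) ` {i. i < length ws \<and> adj x (ws ! i)}"
      by (force simp: in_set_conv_nth)
  qed
  then show ?thesis by (intro surj_card_le) auto
qed

text \<open>
  Dirac's theorem, localised off a longest cycle \<open>C\<close>, of length \<open>c\<close>. Suppose that every vertex off \<open>C\<close> has degree
  above \<open>c/2\<close>. Take a longest path off \<open>C\<close> whose last vertex is adjacent to some \<open>z0\<close> on \<open>C\<close>, and let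
  \<open>x\<close> be its first vertex, so that all neighbours of \<open>x\<close> off \<open>C\<close> are on the path. Detours through
  the path show that the neighbours of \<open>x\<close> on \<open>C\<close>, apart from \<open>z0\<close>, keep from \<open>z0\<close> a distance
  larger than the number of path vertices and are pairwise nonconsecutive. If there were any, the
  degree of \<open>x\<close> would require more of them than \<open>C\<close> has room for, so \<open>x\<close> has no neighbour on
  \<open>C\<close> except possibly \<open>z0\<close>.

  Let \<open>q\<close> be the last neighbour of \<open>x\<close> along the path continued by \<open>z0\<close>. It would be enough to have
  two disjoint paths to \<open>C\<close>, one from \<open>q\<close> and one from some vertex \<open>a\<close> before \<open>q\<close>: the segment up to
  \<open>q\<close> contains a path from \<open>a\<close> to \<open>q\<close> that visits \<open>x\<close> and all its neighbours, and the longer arc of \<open>C\<close>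
  closes a cycle on more than \<open>c\<close> vertices. To force \<open>q\<close> to be one of the two starting points, the
  vertices before \<open>q\<close> are contracted to one vertex (represented by \<open>x\<close>) before Menger's theorem is
  applied. A separating vertex of the contracted graph would give a separation of \<open>S\<close>.
\<close>

lemma low_degree_off_longest_cycle:
  assumes fin: "finite S" and zs: "cycle zs" "set zs \<subset> S"
    and long: "\<And>ys. cycle ys \<Longrightarrow> set ys \<subseteq> S \<Longrightarrow> length ys \<le> length zs"
    and nosep: "\<And>V W w. \<not> separation S V W w"
  shows "\<exists>v\<in>S - set zs. 2 * card (nbrs S v) \<le> length zs"
proof (rule ccontr)
  assume neg: "\<not> ?thesis"
  define C where "C = set zs"
  define R where "R = S - C"
  define c where "c = length zs"
  have deg: "c + 1 \<le> 2 * card (nbrs S v)" if "v \<in> R" for v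
    using neg that unfolding R_def C_def c_def by (metis Suc_eq_plus1 not_less_eq_eq)
  have CS: "C \<subseteq> S" and cardC: "card C = c" and c3: "3 \<le> c" and finC: "finite C"
    using zs by (auto simp: C_def c_def cycle_card cycle_def)
  have C_big: "\<not> C \<subseteq> {z}" for z using cardC c3 card_mono[of "{z}" C] by auto
  obtain r z where rz: "r \<in> R" "z \<in> C" "adj r z"
  proof (rule ccontr)
    assume no: "\<not> thesis"
    obtain z where z: "z \<in> C" using C_big[of undefined] by blast
    have "separation S (insert z R) C z"
      using no that z CS zs(2) C_big[of z] unfolding separation_def R_def C_def by auto
    then show False using nosep by blast
  qed
  obtain xs where xs: "path xs \<and> set xs \<subseteq> R \<and> xs \<noteq> [] \<and> (\<exists>z\<in>C. adj (last xs) z)"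
    and xs_long: "\<And>ys. path ys \<and> set ys \<subseteq> R \<and> ys \<noteq> [] \<and> (\<exists>z\<in>C. adj (last ys) z) \<Longrightarrow> length ys \<le> length xs"
    by (rule longest_list_exists[of S "\<lambda>xs. path xs \<and> set xs \<subseteq> R \<and> xs \<noteq> [] \<and> (\<exists>z\<in>C. adj (last xs) z)" "[r]"])
      (use fin rz in \<open>auto simp: path_def R_def\<close>)
  then obtain z0 where z0: "z0 \<in> C" "adj (last xs) z0" by blast
  define x where "x = hd xs"
  define p where "p = length xs"
  have xR: "x \<in> R" using xs unfolding x_def by (meson hd_in_set subsetD)
  have p1: "1 \<le> p" using xs unfolding p_def by (cases xs) auto
  have nR: "nbrs R x \<subseteq> set (tl xs)"
  proof
    fix u assume u: "u \<in> nbrs R x"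
    then have "u \<in> set xs"
      using xs_long[of "u # xs"] xs by (auto simp: nbrs_def path_Cons adj_commute x_def)
    moreover have "u \<noteq> x" using u adj_irrefl by (auto simp: nbrs_def)
    ultimately show "u \<in> set (tl xs)" unfolding x_def by (cases xs) auto
  qed
  obtain ws where ws: "cycle ws" "set ws = C" "length ws = c" "hd ws = z0"
    using cycle_hd_at[OF zs(1), of z0] z0(1) unfolding C_def c_def .
  have ws_ne: "ws \<noteq> []" using ws c3 by auto
  then have ws0: "ws ! 0 = z0" using ws(4) by (simp add: hd_conv_nth)
  have xsC: "set xs \<inter> C = {}" using xs R_def by auto
  define N where "N = {i. 0 < i \<and> i < c \<and> adj x (ws ! i)}"
  have finN: "finite N" unfolding N_def by auto
  have too_long: False if "cycle ys" "set ys \<subseteq> C \<union> R" "c < length ys" for ys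
    using long[OF that(1)] that CS unfolding R_def c_def by force
  \<comment> \<open>the path as a detour from \<open>z0\<close> to position \<open>i\<close>, the same the other way round, and \<open>x\<close> alone between two consecutive neighbours\<close>
  have Nlow: "p + 1 \<le> i" and Nhigh: "p + 1 + i \<le> c" and Nstep: "Suc i \<notin> N" if "i \<in> N" for i
  proof -
    have i: "0 < i" "i < c" "adj x (ws ! i)" using that by (auto simp: N_def)
    have "cycle (hd ws # rev xs @ drop i ws)"
      using ws z0 xs xsC i unfolding x_def
      by (intro cycle_detour) (auto simp: path_rev hd_rev last_rev adj_commute)
    moreover have "set (hd ws # rev xs @ drop i ws) \<subseteq> C \<union> R"
      using xs ws ws_ne by (auto dest: in_set_dropD)
    ultimately have "\<not> c < length (hd ws # rev xs @ drop i ws)" using too_long by blast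
    then show "p + 1 \<le> i" using ws i unfolding p_def by simp
    have "path (take (Suc i) ws)" using ws(1) path_take by (auto simp: cycle_def)
    then have tk: "path (take (Suc i) ws)" "take (Suc i) ws \<noteq> []" "last (take (Suc i) ws) = ws ! i"
       "hd (take (Suc i) ws) = z0" "set (take (Suc i) ws) \<subseteq> C"
      using ws i ws_ne set_take_subset[of "Suc i" ws] 
      by (auto simp: path_take cycle_def take_Suc_conv_app_nth hd_append hd_take)
    have "path (take (Suc i) ws @ xs)"
      using tk xs xsC i unfolding path_append x_def by (auto simp: adj_commute)
    then have "cycle (take (Suc i) ws @ xs)"
      using tk xs z0 i ws p1 unfolding cycle_def p_def by (auto simp: min_def)
    moreover have "set (take (Suc i) ws @ xs) \<subseteq> C \<union> R" using tk xs by auto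
    ultimately have "\<not> c < length (take (Suc i) ws @ xs)" using too_long by blast
    then show "p + 1 + i \<le> c" using ws i unfolding p_def by simp
    show "Suc i \<notin> N"
    proof
      assume "Suc i \<in> N"
      then have j: "Suc i < c" "adj x (ws ! Suc i)" by (auto simp: N_def)
      have dr: "path (drop (Suc i) ws)" "drop (Suc i) ws \<noteq> []" "hd (drop (Suc i) ws) = ws ! Suc i"
          "last (drop (Suc i) ws) = last ws" "set (drop (Suc i) ws) \<subseteq> C"
        using ws j set_drop_subset[of "Suc i" ws] by (auto simp: path_drop cycle_def hd_drop_conv_nth)
      have dj: "set (take (Suc i) ws) \<inter> set (drop (Suc i) ws) = {}"
        using cycle_distinct[OF ws(1)] by (simp add: set_take_disj_set_drop_if_distinct)
      have "x \<notin> C" using xR R_def by auto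
      then have "path (take (Suc i) ws @ x # drop (Suc i) ws)"
        using tk dr dj i j unfolding path_append path_Cons by (auto simp: adj_commute)
      then have "cycle (take (Suc i) ws @ x # drop (Suc i) ws)"
        using tk dr ws j unfolding cycle_def by auto
      moreover have "set (take (Suc i) ws @ x # drop (Suc i) ws) \<subseteq> C \<union> R" using tk dr xR by auto
      ultimately have "\<not> c < length (take (Suc i) ws @ x # drop (Suc i) ws)" using too_long by blast
      then show False using ws j by simp
    qed
  qed
  have nC: "nbrs C x \<subseteq> insert z0 ((\<lambda>i. ws ! i) ` N)"
  proof
    fix u assume u: "u \<in> nbrs C x"
    then obtain i where "i < c" "u = ws ! i" using ws by (metis (mono_tags) in_set_conv_nth mem_Collect_eq nbrs_def)
    then show "u \<in> insert z0 ((\<lambda>i. ws ! i) ` N)" using u ws0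
      by (cases "i = 0") (auto simp: N_def nbrs_def)
  qed
  have nS: "nbrs S x = nbrs R x \<union> nbrs C x" using CS by (auto simp: nbrs_def R_def)
  have "N = {}"
  proof (rule ccontr)
    assume "N \<noteq> {}"
    then obtain i where i: "i \<in> N" by blast
    have "N \<inter> Suc ` N = {}" using Nstep by auto
    then have "2 * card N = card (N \<union> Suc ` N)"
      using finN by (simp add: card_Un_disjoint card_image)
    also have "N \<union> Suc ` N \<subseteq> {p + 1..c - p}" using Nlow Nhigh by force
    then have "card (N \<union> Suc ` N) \<le> c - p - p"
      using card_mono[of "{p + 1..c - p}" "N \<union> Suc ` N"] by simp
    finally have N2: "2 * card N \<le> c - p - p" .
    have "nbrs S x \<subseteq> set (tl xs) \<union> {z0} \<union> (\<lambda>i. ws ! i) ` N" using nS nR nC by auto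
    then have "card (nbrs S x) \<le> card (set (tl xs) \<union> {z0} \<union> (\<lambda>i. ws ! i) ` N)"
      using finN by (intro card_mono) auto
    also have "\<dots> \<le> card (set (tl xs)) + card {z0} + card ((\<lambda>i. ws ! i) ` N)"
      by (meson card_Un_le le_refl add_le_mono order_trans)
    also have "\<dots> \<le> (p - 1) + 1 + card N"
      using card_length[of "tl xs"] card_image_le[OF finN] by (auto simp: p_def intro!: add_mono)
    finally have "card (nbrs S x) \<le> p + card N" using p1 by simp
    then show False using deg[OF xR] N2 Nlow[OF i] Nhigh[OF i] by linarith
  qed
  then have nS': "nbrs S x \<subseteq> set (tl xs) \<union> {z0}" using nS nR nC by auto
  have ps: "path (xs @ [z0])" using xs z0 xsC by (auto simp: path_append)
  have "nbrs S x \<noteq> {}" using deg[OF xR] by auto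
  then have "\<exists>u\<in>set (xs @ [z0]). adj x u" using nS' xs by (cases xs) (auto simp: nbrs_def)
  then obtain as q bs where q: "xs @ [z0] = as @ q # bs" "adj x q" "\<forall>b\<in>set bs. \<not> adj x b"
    by (rule split_list_last_propE)
  have as_ne: "as \<noteq> []" using q adj_irrefl xs unfolding x_def by (cases xs; cases as) auto
  have hd_as: "hd as = x" using q(1) as_ne xs unfolding x_def by (metis hd_append2)
  have xs_as: "xs = as @ butlast (q # bs)" using q(1) by (metis butlast_append butlast_snoc list.distinct(1))
  have asR: "set as \<subseteq> R" using xs xs_as by auto
  have nS_as: "nbrs S x \<subseteq> insert q (set as)"
  proof
    fix u assume u: "u \<in> nbrs S x"
    then have "u \<in> set (xs @ [z0])" using nS' by (cases xs) auto
    then show "u \<in> insert q (set as)" using u q by (auto simp: nbrs_def)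
  qed
  have pq: "path (as @ q # bs)" using ps q(1) by simp
  have q_as: "q \<notin> set as" using pq by (auto simp: path_append)
  have xas: "x \<in> set as" using as_ne hd_as by auto
  have xq: "x \<noteq> q" using q_as xas by auto
  have qS: "q \<in> S"
  proof -
    have "q \<in> set (xs @ [z0])" using q(1) by simp
    then show ?thesis using xs z0 CS R_def by auto
  qed
  define T where "T = insert x (S - set as)"
  \<comment> \<open>\<open>blow u\<close> is the set of vertices that the vertex \<open>u\<close> of the contracted graph stands for\<close>
  define blow where "blow u = (if u = x then set as else {u})" for u
  define D where "D = {(u, v) \<in> T \<times> T. \<exists>a\<in>blow u. \<exists>b\<in>blow v. adj a b}"
  have TS: "T \<subseteq> S" using xas asR by (auto simp: T_def R_def)
  have finD: "finite D"
    using fin TS by (intro finite_subset[of D "S \<times> S"]) (auto simp: D_def)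
  have D_adj: "successively adj ys" if "steps D ys" "x \<notin> set ys" for ys
    using that by (induction ys rule: induct_list012) (auto simp: D_def blow_def)
  have xC: "x \<notin> C" using xR R_def by auto
  from finD show False
  proof (cases rule: menger_two[of D "{x, q}" C])
    case (separator w X)
    have XT: "X \<subseteq> T"
    proof -
      have "Range D \<subseteq> T" by (auto simp: D_def)
      moreover have "{x, q} \<subseteq> T" using q_as qS by (auto simp: T_def)
      ultimately show ?thesis using separator(4) by blast
    qed
    \<comment> \<open>without the contracted vertex, the rest \<open>q # bs\<close> of the path still leads from \<open>q\<close> to \<open>z0\<close> on \<open>C\<close>\<close>
    have wx: "w \<noteq> x"
    proof
      assume wx: "w = x"
      have nw: "w \<notin> set (q # bs)" using pq xas wx by (auto simp: path_append)
      have sub: "set (q # bs) \<subseteq> S - set as"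
      proof -
        have "set (q # bs) \<subseteq> set (xs @ [z0])" using q(1) by (metis Un_upper2 set_append)
        moreover have "set (xs @ [z0]) \<subseteq> S" using xs z0 CS R_def by auto
        moreover have "set (q # bs) \<inter> set as = {}" using pq by (auto simp: path_append)
        ultimately show ?thesis by blast
      qed
      have "path (q # bs)" using pq path_append by blast
      then have "successively adj (q # bs)" by (simp add: path_def)
      then have "steps D (q # bs)"
      proof (rule successively_mono)
        fix u v assume uv: "u \<in> set (q # bs)" "v \<in> set (q # bs)" "adj u v"
        then have "u \<noteq> x" "v \<noteq> x" using nw wx by auto
        then show "(u, v) \<in> D" using uv sub by (auto simp: D_def T_def blow_def)
      qed
      then have "set (q # bs) \<subseteq> X"
        using separator(2,5) nw xq wx by (intro steps_closed[of D "q # bs" X w]) auto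
      moreover have "last (q # bs) = z0" using q(1) by (metis last_appendR last_snoc list.distinct(1))
      ultimately show False using separator(3) z0(1) by (metis disjoint_iff last_in_set list.distinct(1) subsetD)
    qed
    then have xX: "x \<in> X" using separator(2) by auto
    define Y where "Y = X \<union> set as"
    \<comment> \<open>if \<open>w\<close> is not a vertex of the contracted graph, nothing leaves \<open>X\<close> and any vertex on the other side can serve as cut vertex\<close>
    define w' where "w' = (if w \<in> T then w else z0)"
    have YC: "Y \<inter> C = {}" using separator(3) asR R_def by (auto simp: Y_def)
    have YS: "Y \<subseteq> S" using XT TS asR R_def by (auto simp: Y_def)
    have w'Y: "w' \<notin> Y" using YC z0(1) separator(1) wx by (auto simp: w'_def Y_def T_def)
    have w'S: "w' \<in> S" using TS z0 CS by (auto simp: w'_def)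
    have "\<not> adj u v" if uv: "u \<in> Y" "v \<in> S - Y" "v \<noteq> w'" for u v
    proof
      assume adj: "adj u v"
      define u' where "u' = (if u \<in> set as then x else u)"
      have u': "u' \<in> X" "u \<in> blow u'"
        using uv(1) xX xas by (auto simp: u'_def Y_def blow_def)
      have v: "v \<in> T" "v \<noteq> x" "v \<noteq> w" using uv xX by (auto simp: T_def Y_def w'_def split: if_splits)
      then have "(u', v) \<in> D" using u' XT adj by (auto simp: D_def blow_def)
      then have "v \<in> X" using separator(5) u'(1) v(3) by blast
      then show False using uv by (auto simp: Y_def)
    qed
    then have "separation S (insert w' Y) (S - Y) w'"
      using YS w'Y w'S xX C_big[of w'] YC CS unfolding separation_def by (auto simp: Y_def)
    then show False using nosep by blast
  next
    case (paths P0 Q0)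
    have "\<exists>P Q. linking D {x, q} C P \<and> linking D {x, q} C Q \<and> set P \<inter> set Q = {} \<and>
        set P \<inter> {x, q} = {x} \<and> set Q \<inter> {x, q} = {q} \<and> hd P = x \<and> hd Q = q \<and>
        set P \<inter> C = {last P} \<and> set Q \<inter> C = {last Q}"
    proof -
      have "hd P0 \<noteq> hd Q0" using paths by (metis disjoint_iff hd_in_set linking_def)
      then consider "hd P0 = x" "hd Q0 = q" | "hd P0 = q" "hd Q0 = x"
        using paths(1,2) unfolding linking_def by auto
      then show ?thesis
      proof cases
        case 1 then show ?thesis using paths by (intro exI[of _ P0] exI[of _ Q0]) simp
      next
        case 2 then show ?thesis using paths by (intro exI[of _ Q0] exI[of _ P0]) (simp add: Int_commute)
      qed
    qed
    then obtain P Q where PQ: "linking D {x, q} C P" "linking D {x, q} C Q" "set P \<inter> set Q = {}"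
        "set P \<inter> {x, q} = {x}" "set Q \<inter> {x, q} = {q}" "hd P = x" "hd Q = q"
        "set P \<inter> C = {last P}" "set Q \<inter> C = {last Q}" by blast
    obtain P1 where P1: "P = x # P1" using PQ(1,6) unfolding linking_def by (cases P) auto
    obtain Q1 where Q1: "Q = q # Q1" using PQ(2,7) unfolding linking_def by (cases Q) auto
    have P1_ne: "P1 \<noteq> []" using PQ(1) xC unfolding P1 linking_def by auto
    have sub: "set ys \<subseteq> T" if "linking D {x, q} C ys" for ys
    proof -
      have st: "steps D ys" "ys \<noteq> []" "hd ys \<in> T" using that q_as qS by (auto simp: linking_def T_def)
      have "set ys \<subseteq> insert (hd ys) (Range D)" using st(1)
        by (induction ys rule: induct_list012) auto
      then show ?thesis using st(3) by (auto simp: D_def)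
    qed
    have distP: "distinct P" "distinct Q" using PQ(1,2) by (auto simp: linking_def)
    have P1T: "set P1 \<subseteq> S - set as" using sub[OF PQ(1)] distP(1) by (auto simp: P1 T_def)
    have QT: "set Q \<subseteq> S - set as" using sub[OF PQ(2)] PQ(5) xq by (auto simp: T_def)
    have pP1: "path P1" using PQ(1) distP(1) D_adj[of P1] unfolding path_def
      by (auto simp: P1 linking_def successively_Cons)
    have pQ: "path Q" using PQ(2,5) distP(2) D_adj[of Q] xq unfolding path_def
      by (auto simp: linking_def)
    define z1 where "z1 = last P1"
    define z2 where "z2 = last Q"
    have z1: "z1 \<in> C" "set P1 \<inter> C = {z1}" "z1 \<in> set P1"
    proof -
      have "last P = z1" using P1_ne by (simp add: P1 z1_def)
      moreover have "set P1 \<inter> C = set P \<inter> C" using xC by (auto simp: P1)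
      ultimately show eq: "set P1 \<inter> C = {z1}" using PQ(8) by metis
      then show "z1 \<in> C" "z1 \<in> set P1" by blast+
    qed
    have z2: "set Q \<inter> C = {z2}" using PQ(9) by (simp only: z2_def)
    then have z2: "z2 \<in> C" "set Q \<inter> C = {z2}" "z2 \<in> set Q" by blast+
    have z12: "z1 \<noteq> z2" using z1(3) z2(3) PQ(3) by (auto simp: P1)
    obtain us where us: "path (z1 # us @ [z2])" "set us \<subseteq> C - {z1, z2}" "c \<le> 2 * length us + 2"
      using cycle_long_arc[OF zs(1) _ _ z12] z1(1) z2(1) unfolding C_def c_def by blast
    have "(x, hd P1) \<in> D" using PQ(1) P1_ne by (simp add: P1 linking_def successively_Cons)
    moreover have "hd P1 \<noteq> x" using distP(1) P1_ne by (auto simp: P1)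
    ultimately obtain a where a: "a \<in> set as" "adj a (hd P1)"
      by (auto simp: D_def blow_def)
    obtain L M where LM: "as = L @ a # M" using a(1) by (meson split_list)
    have "\<exists>b\<in>set (M @ [q]). adj x b" using q(2) by auto
    then obtain M1 b M2 where M: "M @ [q] = M1 @ b # M2" "adj x b" "\<forall>u\<in>set M1. \<not> adj x u"
      by (rule split_list_first_propE)
    have asq: "as @ [q] = (L @ [a]) @ M1 @ b # M2" using LM M(1) by simp
    have "path (as @ [q])" using pq by (auto simp: path_append path_Cons)
    then have pLM: "path ((L @ [a]) @ M1 @ b # M2)" using asq by simp
    \<comment> \<open>from \<open>a\<close> back to \<open>x\<close>, across to the next neighbour \<open>b\<close> of \<open>x\<close> after \<open>a\<close>, and on to \<open>q\<close>; only non-neighbours of \<open>x\<close> are skipped\<close>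
    define A0 where "A0 = rev (L @ [a]) @ b # M2"
    have hdLa: "hd (L @ [a]) = x" using hd_as LM by (cases L) auto
    have lastM: "last (b # M2) = q" using M(1) by (metis last_appendR last_snoc list.distinct(1))
    have pA0: "path A0"
    proof -
      have "path (rev (L @ [a]))" using pLM path_rev path_append by blast
      moreover have "path (b # M2)" using pLM path_append by blast
      moreover have "last (rev (L @ [a])) = x" using hdLa by (simp only: last_rev)
      moreover have "set (L @ [a]) \<inter> set (M1 @ b # M2) = {}" using pLM path_append by blast
      then have "set (rev (L @ [a])) \<inter> set (b # M2) = {}" by auto
      ultimately show ?thesis using M(2) unfolding A0_def path_append[of "rev (L @ [a])"]
        by simp
    qed
    have A0: "hd A0 = a" "last A0 = q" "A0 \<noteq> []" using lastM by (auto simp: A0_def)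
    have setA0: "set A0 \<subseteq> insert q (set as)" using arg_cong[OF asq, of set] by (auto simp: A0_def)
    have "insert x (nbrs S x) \<subseteq> set A0"
    proof -
      have "x \<in> set (L @ [a])" using hdLa by (metis append_is_Nil_conv hd_in_set list.distinct(1))
      moreover have "nbrs S x \<subseteq> set A0"
      proof
        fix u assume u: "u \<in> nbrs S x"
        then have "u \<in> set (as @ [q])" using nS_as by auto
        then show "u \<in> set A0" unfolding asq A0_def using u M(3) by (auto simp: nbrs_def)
      qed
      ultimately show ?thesis by (auto simp: A0_def)
    qed
    then have "card (insert x (nbrs S x)) \<le> length A0"
      by (meson List.finite_set card_length card_mono order_trans)
    moreover have "x \<notin> nbrs S x" using adj_irrefl by (auto simp: nbrs_def)
    ultimately have lenA0: "card (nbrs S x) + 1 \<le> length A0" using finite_nbrs[OF fin] by simp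
    have qR: "set as \<inter> C = {}" using asR R_def by auto
    have lastAQ: "last (A0 @ Q1) = z2" using A0(2) unfolding z2_def Q1 by auto
    have qP1: "q \<notin> set P1" using PQ(4) xq by (auto simp: P1)
    have QP1: "set Q \<inter> set P1 = {}" using PQ(3) by (auto simp: P1)
    have Qus: "set Q \<inter> set us = {}" using z2(2) us(2) by auto
    have P1us: "set P1 \<inter> set us = {}" using z1(2) us(2) by auto
    have pAQ: "path (A0 @ Q1)" using pA0 pQ A0 setA0 QT unfolding Q1 path_append path_Cons by auto
    have pPu: "path (P1 @ us)" using pP1 us(1) P1us P1_ne unfolding path_append path_Cons z1_def
      by (auto simp: hd_append split: if_splits)
    have lastPu: "adj (last (P1 @ us)) z2" using us(1) P1_ne unfolding path_append path_Cons z1_def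
      by (cases "us = []") auto
    have dis: "set (A0 @ Q1) \<inter> set (P1 @ us) = {}"
    proof -
      have "set A0 \<inter> set P1 = {}" using setA0 P1T qP1 by auto
      moreover have "set A0 \<inter> set us = {}" using setA0 qR us(2) Qus by (auto simp: Q1)
      ultimately show ?thesis using QP1 Qus by (auto simp: Q1)
    qed
    have "path ((A0 @ Q1) @ rev (P1 @ us))"
      unfolding path_append[of "A0 @ Q1"] path_rev
      using pAQ pPu lastAQ lastPu dis P1_ne by (auto simp: hd_rev adj_commute simp del: rev_append)
    moreover have "adj (last ((A0 @ Q1) @ rev (P1 @ us))) (hd ((A0 @ Q1) @ rev (P1 @ us)))"
      using a(2) A0 P1_ne by (simp add: last_rev adj_commute)
    moreover have len: "c < length ((A0 @ Q1) @ rev (P1 @ us))"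
    proof -
      have "1 \<le> length P1" using P1_ne by (cases P1) auto
      then show ?thesis using deg[OF xR] us(3) lenA0 by simp
    qed
    ultimately have "cycle ((A0 @ Q1) @ rev (P1 @ us))" using c3 unfolding cycle_def by linarith
    moreover have "set ((A0 @ Q1) @ rev (P1 @ us)) \<subseteq> C \<union> R"
      using setA0 QT P1T us(2) asR qS CS by (auto simp: R_def Q1)
    ultimately show False using too_long len by blast
  qed
qed

section \<open>Edge counts of graphs with bounded circumference\<close>

text \<open>The Erdos-Gallai bound for cycles. The quantity \<open>c (|S| - 1)\<close> is additive over the two sides of
  a cut vertex and drops by \<open>c\<close> when a vertex of degree at most \<open>c/2\<close> is deleted. If neither
  reduction applies, then \<open>low_degree_off_longest_cycle\<close> leaves no vertex off a longest cycle, so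
  \<open>S\<close> has at most \<open>c\<close> vertices and the trivial bound suffices.\<close>

lemma circumference_edge_bound:
  assumes "finite S" "S \<noteq> {}" "2 \<le> c"
    and "\<And>xs. cycle xs \<Longrightarrow> set xs \<subseteq> S \<Longrightarrow> length xs \<le> c"
  shows "2 * ecount S \<le> c * (card S - 1)"
  using assms
proof (induction "card S" arbitrary: S rule: less_induct)
  case less
  note fin = less.prems(1) and short = less.prems(4)
  have n1: "1 \<le> card S" using less.prems(1,2) by (simp add: Suc_leI card_gt_0_iff)
  consider (small) "card S \<le> c"
    | (low) v where "c < card S" "v \<in> S" "2 * card (nbrs S v) \<le> c"
    | (sep) V W w where "separation S V W w"
    | (rest) "c < card S" "\<forall>v\<in>S. c < 2 * card (nbrs S v)" "\<And>V W w. \<not> separation S V W w"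
    by (meson not_le)
  then show ?case
  proof cases
    case small
    have "2 * ecount S \<le> card S * (card S - 1)" by (rule ecount_le[OF fin])
    also have "\<dots> \<le> c * (card S - 1)" using small by (rule mult_le_mono1)
    finally show ?thesis .
  next
    case low
    have card: "card (S - {v}) = card S - 1" using low(2) by simp
    have "S - {v} \<noteq> {}" using card low(1) less.prems(3) by (metis card.empty less_imp_le not_le numeral_2_eq_2 Suc_diff_1 Suc_le_lessD n1 not_less_eq_eq One_nat_def)
    then have "2 * ecount (S - {v}) \<le> c * (card (S - {v}) - 1)"
      using low short card n1 fin less.prems(3) by (intro less.hyps) auto
    then have "2 * ecount S \<le> c * (card S - 1 - 1) + c"
      using ecount_remove[OF low(2)] low(3) card by simp
    also have "\<dots> = c * (card S - 1)"
    proof -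
      obtain k where "card S = Suc (Suc k)" using low(1) less.prems(3)
        by (metis add_2_eq_Suc le_add_diff_inverse less_imp_le order_trans)
      then show ?thesis by simp
    qed
    finally show ?thesis .
  next
    case sep
    have VW: "V \<subset> S" "W \<subset> S" using separation_subset[OF sep] by auto
    have ne: "V \<noteq> {}" "W \<noteq> {}" using sep unfolding separation_def by auto
    have finVW: "finite V" "finite W" using VW fin by (auto intro: finite_subset)
    have V: "2 * ecount V \<le> c * (card V - 1)"
      using VW ne finVW fin short less.prems(3) by (intro less.hyps) (auto intro: psubset_card_mono)
    have W: "2 * ecount W \<le> c * (card W - 1)"
      using VW ne finVW fin short less.prems(3) by (intro less.hyps) (auto intro: psubset_card_mono)
    have "1 \<le> card V" "1 \<le> card W" using ne finVW by (simp_all add: Suc_leI card_gt_0_iff)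
    then have "(card V - 1) + (card W - 1) = card S - 1"
      using separation_card[OF sep fin] by simp
    then have "c * (card S - 1) = c * (card V - 1) + c * (card W - 1)" by (metis distrib_left)
    then show ?thesis using V W separation_ecount[OF sep] by simp
  next
    case rest
    have "2 \<le> card (nbrs S v)" if "v \<in> S" for v using rest(2) that less.prems(3) by fastforce
    then obtain xs0 where xs0: "cycle xs0 \<and> set xs0 \<subseteq> S"
      using cycle_if_min_degree_two[OF fin less.prems(2)] by blast
    obtain zs where zs: "cycle zs \<and> set zs \<subseteq> S"
        and long: "\<And>ys. cycle ys \<and> set ys \<subseteq> S \<Longrightarrow> length ys \<le> length zs"
      by (rule longest_list_exists[of S "\<lambda>xs. cycle xs \<and> set xs \<subseteq> S" xs0])
        (use fin xs0 cycle_distinct in auto)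
    have "length zs \<le> c" using short zs by blast
    then have "set zs \<subset> S" using rest(1) cycle_card[of zs] zs by force
    then obtain v where "v \<in> S" "2 * card (nbrs S v) \<le> length zs"
      using low_degree_off_longest_cycle[OF fin, of zs] zs long rest(3) by blast
    then show ?thesis using rest(2) \<open>length zs \<le> c\<close> by fastforce
  qed
qed

text \<open>The same induction, with the cycle kept intact. At a cut vertex the cycle stays on one side, and
  the Erdos-Gallai bound handles the other side.\<close>

lemma edges_off_longest_cycle:
  assumes "finite S" "cycle zs" "set zs \<subseteq> S"
    and "\<And>xs. cycle xs \<Longrightarrow> set xs \<subseteq> S \<Longrightarrow> length xs \<le> length zs"
  shows "2 * ecount S \<le> 2 * ecount (set zs) + length zs * (card S - length zs)"
  using assms
proof (induction "card S" arbitrary: S rule: less_induct)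
  case less
  note fin = less.prems(1) and zs = less.prems(2,3) and short = less.prems(4)
  define c where "c = length zs"
  have c: "card (set zs) = c" "3 \<le> c" using zs by (auto simp: cycle_card c_def cycle_def)
  consider (all) "set zs = S"
    | (low) v where "v \<in> S - set zs" "2 * card (nbrs S v) \<le> c"
    | (sep) V W w where "separation S V W w"
    using low_degree_off_longest_cycle[OF fin zs(1) _ short] zs(2) unfolding c_def by blast
  then show ?case
  proof cases
    case all
    then show ?thesis by simp
  next
    case low
    have sub: "set zs \<subseteq> S - {v}" using low zs by auto
    have card: "card (S - {v}) = card S - 1" using low by simp
    have "card (S - {v}) < card S" using low fin by (meson DiffD1 card_Diff1_less)
    then have IH: "2 * ecount (S - {v}) \<le> 2 * ecount (set zs) + c * (card (S - {v}) - c)"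
      using fin zs(1) sub short unfolding c_def by (intro less.hyps) auto
    have "c \<le> card (S - {v})" using c(1) card_mono[OF _ sub] fin by simp
    then have "c * (card S - c) = c * (card (S - {v}) - c) + c"
      using card low fin by (metis (no_types, lifting) Suc_diff_1 Suc_diff_le DiffD1 add.commute card_gt_0_iff empty_iff mult_Suc_right)
    then show ?thesis using IH ecount_remove[of v S] low unfolding c_def by simp
  next
    case sep
    have main: "2 * ecount S \<le> 2 * ecount (set zs) + c * (card S - c)"
      if sp: "separation S V W w" and sub: "set zs \<subseteq> V" for V W
    proof -
      have VW: "V \<subset> S" "W \<subset> S" using separation_subset[OF sp] by auto
      have ne: "W \<noteq> {}" using sp unfolding separation_def by auto
      have finVW: "finite V" "finite W" using VW fin by (auto intro: finite_subset)
      have V: "2 * ecount V \<le> 2 * ecount (set zs) + c * (card V - c)"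
        using VW finVW fin zs(1) sub short unfolding c_def
        by (intro less.hyps) (auto intro: psubset_card_mono)
      have W: "2 * ecount W \<le> c * (card W - 1)"
        using VW ne finVW c(2) short unfolding c_def by (intro circumference_edge_bound) auto
      have "c \<le> card V" using c(1) card_mono[OF finVW(1) sub] by simp
      moreover have "1 \<le> card W" using ne finVW by (simp add: Suc_leI card_gt_0_iff)
      ultimately have "card S - c = (card V - c) + (card W - 1)"
        using separation_card[OF sp fin] by simp
      then have "c * (card S - c) = c * (card V - c) + c * (card W - 1)" by (metis distrib_left)
      then show ?thesis using V W separation_ecount[OF sp] unfolding c_def by simp
    qed
    \<comment> \<open>a cycle with vertices strictly on both sides would contain a path between them that avoids the cut vertex\<close>
    have "set zs \<subseteq> V \<or> set zs \<subseteq> W"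
    proof (rule ccontr)
      assume "\<not> ?thesis"
      then obtain a b where ab: "a \<in> set zs" "a \<in> W - {w}" "b \<in> set zs" "b \<in> V - {w}"
        using sep zs(2) unfolding separation_def by blast
      then have "a \<noteq> b" using sep unfolding separation_def by blast
      show False
      proof -
        obtain us where us: "path (a # us @ [b])" "set us \<subseteq> set zs" "w \<notin> set us"
          by (rule cycle_path_avoiding[OF zs(1) ab(1,3) \<open>a \<noteq> b\<close>, of w]) (use ab in auto)
        have "set (a # us @ [b]) \<subseteq> W - {w}"
        proof -
          have "u \<in> W - {w} \<Longrightarrow> adj u v \<Longrightarrow> v \<in> S \<Longrightarrow> v \<noteq> w \<Longrightarrow> v \<in> W - {w}" for u v
            using sep adj_sym unfolding separation_def by blast
          then have "steps {(u, v). adj u v \<and> v \<in> S} (a # us @ [b]) \<Longrightarrow> ?thesis"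
            using ab us by (intro steps_closed[of "{(u, v). adj u v \<and> v \<in> S}" _ _ w]) auto
          moreover have "successively adj (a # us @ [b])" using us(1) by (simp add: path_def)
          then have "steps {(u, v). adj u v \<and> v \<in> S} (a # us @ [b])"
            by (rule successively_mono) (use us(2) ab zs(2) in auto)
          ultimately show ?thesis by blast
        qed
        then show False using ab sep unfolding separation_def by auto
      qed
    qed
    then show ?thesis using main[OF sep] main[OF separation_sym[OF sep]] unfolding c_def by blast
  qed
qed

section \<open>Weak pancyclicity\<close>

lemma mod_add_right_inj:
  fixes a b :: nat
  assumes "(a + d) mod m = (b + d) mod m" "a < m" "b < m"
  shows "a = b"
  using assms
proof (induction a b rule: linorder_wlog)
  case (le a b)
  then have "m dvd (b + d) - (a + d)" using mod_eq_dvd_iff_nat[of "a + d" "b + d" m] by simp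
  then have "m dvd b - a" by simp
  moreover have "b - a < m" using le by simp
  ultimately have "b - a = 0" using dvd_imp_le[of m "b - a"] by linarith
  then show ?case using le by simp
next
  case (sym a b)
  then show ?case by simp
qed

text \<open>Summed over all consecutive pairs of the cycle, the degree sums add up to four times the number
  of edges, so some pair exceeds the length of the cycle.\<close>

lemma rich_consecutive_pair:
  assumes "cycle xs" "length xs * length xs < 4 * ecount (set xs)"
  obtains ys where "cycle ys" "set ys = set xs" "length ys = length xs"
    "length xs < card (nbrs (set xs) (hd ys)) + card (nbrs (set xs) (last ys))"
proof (rule ccontr)
  assume no: "\<not> thesis"
  define m where "m = length xs"
  define g where "g k = card (nbrs (set xs) (hd (rotate k xs)))" for k
  have ne: "xs \<noteq> []" using assms(1) by (auto simp: cycle_def)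
  have le: "g k + g (Suc k) \<le> m" for k
  proof (rule ccontr)
    assume "\<not> ?thesis"
    moreover have "last (rotate (Suc k) xs) = hd (rotate k xs)"
      using ne by (cases "rotate k xs") auto
    ultimately show False
      using no that[of "rotate (Suc k) xs"] cycle_rotate[OF assms(1), of "Suc k"]
      unfolding g_def m_def by (simp del: rotate_Suc)
  qed
  have "(\<Sum>k<m. g k) = (\<Sum>k<m. card (nbrs (set xs) (xs ! k)))"
    unfolding g_def m_def by (intro sum.cong) (auto simp: hd_rotate_conv_nth ne)
  also have "\<dots> = (\<Sum>v\<in>set xs. card (nbrs (set xs) v))"
    using bij_betw_nth[OF cycle_distinct[OF assms(1)] refl refl] unfolding m_def
    by (intro sum.reindex_bij_betw) (simp add: lessThan_def atLeast0LessThan)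
  also have "\<dots> = 2 * ecount (set xs)" by (rule handshake) simp
  finally have sum: "(\<Sum>k<m. g k) = 2 * ecount (set xs)" .
  have "g m = g 0" unfolding g_def m_def by simp
  then have "(\<Sum>k<m. g (Suc k)) = (\<Sum>k<m. g k)"
    using sum.lessThan_Suc_shift[of g m] by simp
  then have "(\<Sum>k<m. g k + g (Suc k)) = 4 * ecount (set xs)"
    using sum by (simp add: sum.distrib)
  moreover have "(\<Sum>k<m. g k + g (Suc k)) \<le> m * m"
    using sum_bounded_above[of "{..<m}" "\<lambda>k. g k + g (Suc k)" m] le by simp
  ultimately show False using assms(2) unfolding m_def by simp
qed

lemma nbrs_card_inner_positions:
  assumes "set ys = S" "y \<in> S" "k0 < length ys" "\<And>k. k < length ys \<Longrightarrow> adj y (ys ! k) \<Longrightarrow> k = k0 \<or> k \<in> N"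
    "finite N"
  shows "card (nbrs S y) \<le> card {k \<in> N. k < length ys \<and> adj y (ys ! k)} + 1"
proof -
  have "nbrs S y \<subseteq> (\<lambda>k. ys ! k) ` (insert k0 {k \<in> N. k < length ys \<and> adj y (ys ! k)})"
  proof
    fix u assume "u \<in> nbrs S y"
    then obtain k where "k < length ys" "u = ys ! k" "adj y (ys ! k)"
      using assms(1) by (auto simp: nbrs_def in_set_conv_nth)
    then show "u \<in> (\<lambda>k. ys ! k) ` (insert k0 {k \<in> N. k < length ys \<and> adj y (ys ! k)})"
      using assms(4)[of k] by auto
  qed
  then have "card (nbrs S y) \<le> card (insert k0 {k \<in> N. k < length ys \<and> adj y (ys ! k)})"
    using assms(5) by (intro surj_card_le) auto
  also have "\<dots> \<le> card {k \<in> N. k < length ys \<and> adj y (ys ! k)} + 1"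
    using assms(5) by (simp add: card_insert_if)
  finally show ?thesis .
qed

text \<open>Bondy's argument. Let \<open>x\<close> and \<open>y\<close> be the first and the last vertex of a spanning cycle, with
  degree sum above \<open>m\<close>. A neighbour of \<open>x\<close> at position \<open>a\<close> and a neighbour of \<open>y\<close> at position
  \<open>b\<close> give a cycle of length \<open>l\<close> if \<open>b = a + l - 3\<close> (run along the segment from \<open>a\<close> to \<open>b\<close>) or
  \<open>b = a + l - m - 1\<close> (use the two outer segments). The map \<open>a \<mapsto> b\<close> is a cyclic shift of the
  \<open>m - 2\<close> inner positions, which is a bijection, so the degree sum forces a match.\<close>

lemma hamiltonian_pancyclic:
  assumes "cycle xs" "length xs * length xs < 4 * ecount (set xs)" "3 \<le> l" "l \<le> length xs"
  shows "\<exists>ys. cycle ys \<and> set ys \<subseteq> set xs \<and> length ys = l"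
proof -
  define S where "S = set xs"
  define m where "m = length xs"
  obtain ys where ys: "cycle ys" "set ys = S" "length ys = m"
    and rich: "m < card (nbrs S (hd ys)) + card (nbrs S (last ys))"
    using rich_consecutive_pair[OF assms(1,2)] unfolding S_def m_def .
  have m3: "3 \<le> m" using assms(3,4) by (simp add: m_def)
  have ne: "ys \<noteq> []" and dist: "distinct ys" and pys: "path ys"
    using ys m3 cycle_distinct by (auto simp: cycle_def)
  have h: "hd ys = ys ! 0" and la: "last ys = ys ! (m - 1)" and cl: "adj (last ys) (hd ys)"
    using ne ys by (auto simp: hd_conv_nth last_conv_nth cycle_def)
  define I where "I = {k \<in> {1..m - 2}. k < length ys \<and> adj (hd ys) (ys ! k)}"
  define J where "J = {k \<in> {1..m - 2}. k < length ys \<and> adj (last ys) (ys ! k)}"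
  have inS: "hd ys \<in> S" "last ys \<in> S" using ne ys(2) by auto
  have "card (nbrs S (hd ys)) \<le> card I + 1" unfolding I_def
  proof (rule nbrs_card_inner_positions[of _ _ _ "m - 1"])
    fix k assume k: "k < length ys" "adj (hd ys) (ys ! k)"
    have "k \<noteq> 0" using k(2) h adj_irrefl by metis
    then show "k = m - 1 \<or> k \<in> {1..m - 2}" using k ys by auto
  qed (use ys m3 inS in auto)
  moreover have "card (nbrs S (last ys)) \<le> card J + 1" unfolding J_def
  proof (rule nbrs_card_inner_positions[of _ _ _ 0])
    fix k assume k: "k < length ys" "adj (last ys) (ys ! k)"
    have "k \<noteq> m - 1" using k(2) la adj_irrefl by metis
    then show "k = 0 \<or> k \<in> {1..m - 2}" using k ys by auto
  qed (use ys m3 inS ne in auto)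
  ultimately have IJ: "m - 2 < card I + card J" using rich m3 by linarith
  \<comment> \<open>positions count from 0, so the inner ones are \<open>1, ..., m - 2\<close>; for such \<open>a\<close> this is the shift by \<open>l - 3\<close>\<close>
  define f where "f a = 1 + (a + l - 4) mod (m - 2)" for a
  have f_inj: "inj_on f {1..m - 2}"
  proof (rule inj_onI)
    fix a b assume ab: "a \<in> {1..m - 2}" "b \<in> {1..m - 2}" "f a = f b"
    define d where "d = l - 3"
    have "(a - 1 + d) mod (m - 2) = (b - 1 + d) mod (m - 2)"
    proof -
      have "a + l - 4 = a - 1 + d" "b + l - 4 = b - 1 + d" using ab assms(3) by (auto simp: d_def)
      then show ?thesis using ab(3) by (simp add: f_def)
    qed
    moreover have "a - 1 < m - 2" "b - 1 < m - 2" using ab by auto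
    ultimately have "a - 1 = b - 1" by (rule mod_add_right_inj)
    then show "a = b" using ab by auto
  qed
  have "f ` I \<inter> J \<noteq> {}"
  proof
    assume em: "f ` I \<inter> J = {}"
    have I: "I \<subseteq> {1..m - 2}" by (auto simp: I_def)
    have fin: "finite I" "finite J" by (auto simp: I_def J_def)
    have "card (f ` I) = card I" using inj_on_subset[OF f_inj I] by (rule card_image)
    then have "card I + card J = card (f ` I \<union> J)" using fin em by (simp add: card_Un_disjoint)
    also have "\<dots> \<le> card {1..m - 2}"
    proof (rule card_mono)
      have "(a + l - 4) mod (m - 2) < m - 2" for a using m3 by simp
      then have "f a \<in> {1..m - 2}" for a unfolding f_def using m3 
        by (metis Suc_eq_plus1_left Suc_leI atLeastAtMost_iff le_add1)
      then show "f ` I \<union> J \<subseteq> {1..m - 2}" by (auto simp: J_def)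
    qed simp
    finally show False using IJ by simp
  qed
  then obtain a where a: "a \<in> I" "f a \<in> J" by blast
  then have a1: "1 \<le> a" "a \<le> m - 2" "adj (hd ys) (ys ! a)" "adj (last ys) (ys ! f a)"
    by (auto simp: I_def J_def)
  have td: "set (take i ys) \<inter> set (drop j ys) = {}" if "i \<le> j" for i j
    using set_take_disj_set_drop_if_distinct[OF dist that] .
  show ?thesis
  proof (cases "a + l - 4 < m - 2")
    case True
    then have fa: "f a = a + l - 3" using a1 assms(3) by (simp add: f_def)
    define seg where "seg = take (l - 2) (drop a ys)"
    have len: "length seg = l - 2" using True a1 assms(3) ys unfolding seg_def by simp
    have seg: "seg \<noteq> []" "hd seg = ys ! a" using len a1 assms(3) ys m3
      by (auto simp: seg_def hd_drop_conv_nth)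
    have "last seg = seg ! (l - 3)" using seg(1) len assms(3) by (simp add: last_conv_nth numeral_eq_Suc)
    also have "\<dots> = ys ! f a" using fa assms(3) True a1 ys unfolding seg_def by (simp add: add.commute)
    finally have lseg: "last seg = ys ! f a" .
    have "path seg" unfolding seg_def using pys path_take path_drop by blast
    have "hd ys \<in> set (take a ys)" using a1 ne by (cases ys; cases a) auto
    moreover have "set seg \<subseteq> set (drop a ys)" unfolding seg_def by (rule set_take_subset)
    ultimately have hs: "hd ys \<notin> set seg" using td[of a a] by blast
    have "last ys \<in> set (drop (m - 1) ys)" using ys ne m3
      by (metis One_nat_def diff_Suc_less last_drop last_in_set drop_eq_Nil2 leD length_greater_0_conv)
    moreover have "seg = drop a (take (l - 2 + a) ys)" unfolding seg_def by (rule take_drop)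
    then have "set seg \<subseteq> set (take (l - 2 + a) ys)" by (simp add: set_drop_subset)
    moreover have "l - 2 + a \<le> m - 1" using True a1 assms(3) by simp
    ultimately have ls: "last ys \<notin> set seg" using td[of "l - 2 + a" "m - 1"] by blast
    have "path (hd ys # seg @ [last ys])"
      using \<open>path seg\<close> hs ls seg lseg a1 adj_neq[OF cl] unfolding path_Cons path_append
      by (auto simp: adj_commute)
    then have "cycle (hd ys # seg @ [last ys])" using len assms(3) cl unfolding cycle_def by simp
    moreover have "length (hd ys # seg @ [last ys]) = l" using len assms(3) by simp
    moreover have "set (hd ys # seg @ [last ys]) \<subseteq> S"
      using \<open>set seg \<subseteq> set (drop a ys)\<close> set_drop_subset[of a ys] inS ys by auto
    ultimately show ?thesis unfolding S_def by blast
  next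
    case False
    define b where "b = a + l - m - 1"
    have "(a + l - 4) mod (m - 2) = a + l - 4 - (m - 2)"
    proof -
      have "a + l - 4 - (m - 2) < m - 2" using a1 assms(4) m3 unfolding m_def by linarith
      then show ?thesis using False by (metis le_mod_geq mod_less not_less)
    qed
    then have fb: "f a = b" "b < a" "b + 1 + (m - a) = l"
      using False a1 assms(3,4) m3 unfolding f_def b_def m_def by auto
    have T: "path (take (Suc b) ys)" "hd (take (Suc b) ys) = hd ys" "take (Suc b) ys \<noteq> []"
      using pys path_take ne by (auto simp: hd_take)
    have "last (take (Suc b) ys) = ys ! b" using fb a1 ys by (simp add: take_Suc_conv_app_nth)
    note T = T this
    have Dr: "path (drop a ys)" "drop a ys \<noteq> []" "hd (drop a ys) = ys ! a" "last (drop a ys) = last ys"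
      using pys a1 ys m3 by (auto simp: path_drop hd_drop_conv_nth)
    have "path (take (Suc b) ys @ rev (drop a ys))"
      using T Dr td[of "Suc b" a] fb a1 unfolding path_append path_rev
      by (auto simp: hd_rev adj_commute)
    then have "cycle (take (Suc b) ys @ rev (drop a ys))"
      using T Dr a1 fb ys assms(3) unfolding cycle_def by (auto simp: last_rev adj_commute)
    moreover have "length (take (Suc b) ys @ rev (drop a ys)) = l" using fb a1 ys by simp
    moreover have "set (take (Suc b) ys @ rev (drop a ys)) \<subseteq> S"
      using set_take_subset[of "Suc b" ys] set_drop_subset[of a ys] ys by auto
    ultimately show ?thesis unfolding S_def by blast
  qed
qed

lemma cyclic_closed_full:
  fixes U :: "nat set"
  assumes "U \<subseteq> {..<c}" "t0 \<in> U" "\<And>t. t \<in> U \<Longrightarrow> Suc t mod c \<in> U"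
  shows "U = {..<c}"
proof -
  have t0: "t0 < c" using assms by auto
  have step: "(t0 + k) mod c \<in> U" for k
  proof (induction k)
    case 0
    then show ?case using assms t0 by simp
  next
    case (Suc k)
    then show ?case using assms(3)[OF Suc] by (simp add: mod_Suc_eq)
  qed
  have "s \<in> U" if "s < c" for s
  proof -
    have "(t0 + (s + c - t0)) mod c = s" using t0 that by simp
    then show ?thesis using step by metis
  qed
  then show ?thesis using assms(1) by auto
qed

text \<open>A Cauchy-Davenport type count: the set of positions at distance \<open>1, ..., p\<close> after \<open>I\<close> grows by
  at least one with each unit of distance, unless it is already everything.\<close>

lemma cyclic_window_card:
  fixes I J :: "nat set"
  assumes "I \<subseteq> {..<c}" "J \<subseteq> {..<c}" "I \<noteq> {}" "J \<noteq> {}" "1 \<le> p"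
    and apart: "\<And>i j. i \<in> I \<Longrightarrow> 1 \<le> j \<Longrightarrow> j \<le> p \<Longrightarrow> (i + j) mod c \<notin> J"
  shows "card I + card J + p \<le> c + 1"
proof -
  define U where "U q = (\<lambda>(i, j). (i + j) mod c) ` (I \<times> {1..q})" for q
  have c0: "0 < c" using assms by auto
  have Usub: "U q \<subseteq> {..<c}" for q using c0 by (auto simp: U_def)
  have finU: "finite (U q)" for q using Usub finite_subset by blast
  have UJ: "U p \<inter> J = {}" using apart by (auto simp: U_def)
  have Umono: "U q \<subseteq> U q'" if "q \<le> q'" for q q' using that by (auto simp: U_def)
  have "card I + q \<le> card (U (Suc q))" if "Suc q \<le> p" for q
    using that
  proof (induction q)
    case 0
    have "U (Suc 0) = (\<lambda>i. Suc i mod c) ` I" by (auto simp: U_def image_iff)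
    moreover have "inj_on (\<lambda>i. Suc i mod c) I"
    proof (rule inj_onI)
      fix i j assume "i \<in> I" "j \<in> I" "Suc i mod c = Suc j mod c"
      then show "i = j" using assms(1) mod_add_right_inj[of i 1 c j] by auto
    qed
    ultimately show ?case by (simp add: card_image)
  next
    case (Suc q)
    \<comment> \<open>otherwise \<open>U (Suc q)\<close> is closed under the cyclic successor, hence everything, and meets \<open>J\<close>\<close>
    have "U (Suc q) \<noteq> U (Suc (Suc q))"
    proof
      assume eq: "U (Suc q) = U (Suc (Suc q))"
      obtain i where "i \<in> I" using assms(3) by blast
      then have "Suc i mod c \<in> U (Suc q)" unfolding U_def by (auto intro!: image_eqI[of _ _ "(i, 1)"])
      moreover have "Suc t mod c \<in> U (Suc q)" if t: "t \<in> U (Suc q)" for t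
      proof -
        obtain i j where ij: "i \<in> I" "1 \<le> j" "j \<le> Suc q" "t = (i + j) mod c" using t by (auto simp: U_def)
        then have "Suc t mod c = (i + Suc j) mod c" by (simp add: mod_Suc_eq)
        then have "Suc t mod c \<in> U (Suc (Suc q))" using ij unfolding U_def
          by (intro image_eqI[of _ _ "(i, Suc j)"]) auto
        then show ?thesis using eq by simp
      qed
      ultimately have "U (Suc q) = {..<c}" by (intro cyclic_closed_full[OF Usub]) auto
      then have "J \<subseteq> U p" using Umono[of "Suc q" p] Suc.prems assms(2) by auto
      then show False using UJ assms(4) by auto
    qed
    then have "card (U (Suc q)) < card (U (Suc (Suc q)))"
      using Umono[of "Suc q" "Suc (Suc q)"] finU by (intro psubset_card_mono) auto
    then show ?case using Suc by simp
  qed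
  from this[of "p - 1"] have "card I + (p - 1) \<le> card (U p)" using assms(5) by simp
  moreover have "card (U p) + card J \<le> c"
  proof -
    have "finite J" using assms(2) finite_subset by blast
    then have "card (U p) + card J = card (U p \<union> J)" using finU UJ by (simp add: card_Un_disjoint)
    also have "\<dots> \<le> card {..<c}" using Usub assms(2) by (intro card_mono) auto
    finally show ?thesis by simp
  qed
  ultimately show ?thesis using assms(5) by linarith
qed

text \<open>Let \<open>k\<close> be the number of vertices and \<open>c\<close> the length of a longest cycle. A vertex \<open>v\<close> off that
  cycle whose deletion leaves more than \<open>(k - 1)\<^sup>2/4\<close> edges is removed
  by induction. Otherwise all vertices off the cycle have degree at least \<open>k/2\<close>. A longest path on
  \<open>p\<close> vertices off the cycle has ends with at most \<open>p - 1\<close> neighbours off the cycle each, hence with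
  at least \<open>k/2 - p + 1\<close> neighbours on it. A neighbour of the second end at distance at most \<open>p\<close>
  after a neighbour of the first would allow a lengthening detour. The window count then gives
  \<open>k - p + 1 \<le> c\<close>, which contradicts \<open>p \<le> k - c\<close>.\<close>

lemma weakly_pancyclic:
  assumes "finite S" "card S * card S < 4 * ecount S"
    and "cycle zs" "set zs \<subseteq> S" "card S < 2 * length zs" "3 \<le> l" "l \<le> length zs"
  shows "\<exists>ys. cycle ys \<and> set ys \<subseteq> S \<and> length ys = l"
  using assms
proof (induction "card S" arbitrary: S zs rule: less_induct)
  case less
  note fin = less.prems(1) and dense = less.prems(2)
  obtain ws where ws: "cycle ws \<and> set ws \<subseteq> S"
      and long: "\<And>ys. cycle ys \<and> set ys \<subseteq> S \<Longrightarrow> length ys \<le> length ws"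
    by (rule longest_list_exists[of S "\<lambda>xs. cycle xs \<and> set xs \<subseteq> S" zs])
      (use fin less.prems cycle_distinct in auto)
  define C where "C = set ws"
  define R where "R = S - C"
  define c where "c = length ws"
  define k where "k = card S"
  have zc: "length zs \<le> c" using long less.prems unfolding c_def by blast
  have kc: "k < 2 * c" using zc less.prems(5) unfolding k_def by linarith
  have cardC: "card C = c" using ws cycle_card by (auto simp: C_def c_def)
  have CS: "C \<subseteq> S" "finite C" "finite R" using ws fin by (auto simp: C_def R_def)
  have rk: "card R + c = k" using CS cardC fin card_mono[of S C] unfolding R_def k_def
    by (simp add: card_Diff_subset)
  consider (ham) "R = {}" | (del) v where "v \<in> R" "(k - 1) * (k - 1) < 4 * ecount (S - {v})"
    | (rich) "R \<noteq> {}" "\<forall>v\<in>R. 4 * ecount (S - {v}) \<le> (k - 1) * (k - 1)"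
    using not_le by blast
  then show ?case
  proof cases
    case ham
    then have "C = S" using CS by (auto simp: R_def)
    then show ?thesis
      using hamiltonian_pancyclic[of ws l] ws dense cardC zc less.prems(6,7) by (auto simp: C_def c_def)
  next
    case del
    have "card (S - {v}) = k - 1" using del CS by (simp add: R_def k_def)
    moreover have "card (S - {v}) < card S" using del fin card_Diff1_less[of S v] by (simp add: R_def)
    moreover have "set ws \<subseteq> S - {v}" using del ws by (auto simp: R_def C_def)
    ultimately have "\<exists>ys. cycle ys \<and> set ys \<subseteq> S - {v} \<and> length ys = l"
      using del fin ws kc zc less.prems(6,7) unfolding c_def
      by (intro less.hyps[of "S - {v}" ws]) auto
    then show ?thesis by blast
  next
    case rich
    have deg: "k \<le> 2 * card (nbrs S v)" if "v \<in> R" for v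
    proof -
      have "v \<in> S" using that by (simp add: R_def)
      then have "k * k < 4 * ecount (S - {v}) + 4 * card (nbrs S v)"
        using dense ecount_remove[of v S] unfolding k_def by simp
      moreover have "4 * ecount (S - {v}) \<le> (k - 1) * (k - 1)" using rich that by blast
      ultimately have "k * k < (k - 1) * (k - 1) + 4 * card (nbrs S v)" by linarith
      moreover obtain k' where "k = Suc k'" using \<open>v \<in> S\<close> fin unfolding k_def
        by (metis card_gt_0_iff empty_iff gr0_implies_Suc)
      ultimately show ?thesis by simp
    qed
    obtain r where r: "r \<in> R" using rich by blast
    obtain xs where xs: "path xs \<and> set xs \<subseteq> R \<and> xs \<noteq> []"
      and xs_long: "\<And>ys. path ys \<and> set ys \<subseteq> R \<and> ys \<noteq> [] \<Longrightarrow> length ys \<le> length xs"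
      by (rule longest_list_exists[of R "\<lambda>xs. path xs \<and> set xs \<subseteq> R \<and> xs \<noteq> []" "[r]"])
        (use CS r in \<open>auto simp: path_def\<close>)
    define p where "p = length xs"
    have p1: "1 \<le> p" using xs unfolding p_def by (cases xs) auto
    have pr: "p \<le> card R"
      using xs CS card_mono[of R "set xs"] distinct_card[of xs] unfolding p_def path_def by auto
    have attach: "k + 2 \<le> 2 * card (nbrs C x) + 2 * p" if x: "x \<in> R" "x \<in> set xs" and R: "nbrs R x \<subseteq> set xs" for x
    proof -
      have "nbrs S x \<subseteq> nbrs C x \<union> (set xs - {x})"
        using R adj_irrefl by (auto simp: nbrs_def R_def)
      then have "card (nbrs S x) \<le> card (nbrs C x \<union> (set xs - {x}))"
        using CS by (intro card_mono) (auto simp: finite_nbrs)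
      also have "\<dots> \<le> card (nbrs C x) + card (set xs - {x})" by (rule card_Un_le)
      also have "card (set xs - {x}) = p - 1"
        using x xs distinct_card[of xs] by (auto simp: p_def path_def)
      finally show ?thesis using deg[OF x(1)] p1 by linarith
    qed
    have ends: "nbrs R (hd xs) \<subseteq> set xs" "nbrs R (last xs) \<subseteq> set xs"
    proof -
      show "nbrs R (hd xs) \<subseteq> set xs"
        using xs_long[of "u # xs" for u] xs by (fastforce simp: nbrs_def path_Cons adj_commute)
      show "nbrs R (last xs) \<subseteq> set xs"
        using xs_long[of "xs @ [u]" for u] xs by (fastforce simp: nbrs_def path_append)
    qed
    have mem: "hd xs \<in> R" "hd xs \<in> set xs" "last xs \<in> R" "last xs \<in> set xs" using xs by auto
    have dx: "k + 2 \<le> 2 * card (nbrs C (hd xs)) + 2 * p" by (rule attach[OF mem(1,2) ends(1)])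
    have dy: "k + 2 \<le> 2 * card (nbrs C (last xs)) + 2 * p" by (rule attach[OF mem(3,4) ends(2)])
    define I where "I = {i. i < length ws \<and> adj (hd xs) (ws ! i)}"
    define J where "J = {i. i < length ws \<and> adj (last xs) (ws ! i)}"
    have cI: "card (nbrs C (hd xs)) \<le> card I" and cJ: "card (nbrs C (last xs)) \<le> card J"
      unfolding I_def J_def C_def by (intro nbrs_card_le_positions; simp)+
    have pc: "p < c" using pr rk kc by linarith
    have "card I \<noteq> 0" "card J \<noteq> 0" using cI cJ dx dy pr rk kc by linarith+
    then have IJne: "I \<noteq> {}" "J \<noteq> {}" by auto
    have "card I + card J + p \<le> c + 1"
    proof (rule cyclic_window_card[OF _ _ IJne p1])
      fix i j assume ij: "i \<in> I" "1 \<le> j" "j \<le> p"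
      show "(i + j) mod c \<notin> J"
      proof
        assume J: "(i + j) mod c \<in> J"
        define us where "us = rotate i ws"
        have us: "cycle us" "length us = c" "set us = C" using ws cycle_rotate by (auto simp: us_def c_def C_def)
        have "hd us = ws ! i" using ij(1) ws unfolding us_def I_def
          by (subst hd_rotate_conv_nth) auto
        moreover have "us ! j = ws ! ((i + j) mod c)" using ij pc unfolding us_def c_def by (simp add: nth_rotate)
        moreover have "set xs \<inter> C = {}" using xs by (auto simp: R_def)
        ultimately have "cycle (hd us # xs @ drop j us)"
          using us xs ij J pc unfolding I_def J_def by (intro cycle_detour) (auto simp: adj_commute)
        moreover have "set (hd us # xs @ drop j us) \<subseteq> S"
        proof -
          have "hd us \<in> C" using us pc hd_in_set[of us] by fastforce
          then show ?thesis using xs us CS set_drop_subset[of j us] by (auto simp: R_def)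
        qed
        ultimately have "length (hd us # xs @ drop j us) \<le> c" using long unfolding c_def by blast
        then show False using us ij pc unfolding p_def by simp
      qed
    qed (auto simp: I_def J_def c_def)
    then show ?thesis using cI cJ dx dy pr rk by linarith
  qed
qed

section \<open>Graphs whose longest cycle covers barely half of the vertices\<close>

text \<open>The classical rotation: if \<open>v\<close> is adjacent to two vertices of a cycle whose successors are
  adjacent to each other, then \<open>v\<close> can be added to the cycle.\<close>

lemma cycle_crossing:
  assumes "cycle (w # A @ B)" "v \<notin> set (w # A @ B)" "A \<noteq> []" "B \<noteq> []"
    "adj v w" "adj v (last A)" "adj (hd A) (hd B)"
  shows "cycle (v # w # rev B @ A)"
proof -
  have p: "path (w # A @ B)" "adj (last B) w" using assms(1,4) by (auto simp: cycle_def)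
  have pA: "path A" and pB: "path B" and AB: "set A \<inter> set B = {}" and w: "w \<notin> set A" "w \<notin> set B"
    using p(1) unfolding path_Cons path_append by auto
  have "path (rev B @ A)"
    using pA pB AB assms(3,4,7) unfolding path_append path_rev by (auto simp: last_rev adj_commute)
  then have "path (v # w # rev B @ A)"
    using w p(2) assms unfolding path_Cons by (auto simp: hd_rev adj_commute hd_append)
  then show ?thesis using assms unfolding cycle_def
    by (cases A; cases B) (auto simp: adj_commute)
qed

text \<open>The successors of the \<open>d\<close> neighbours of \<open>v\<close> on a longest cycle are pairwise nonadjacent, which
  costs \<open>d (d - 1)/2\<close> edges inside the cycle.\<close>

lemma off_cycle_degree_bound:
  assumes zs: "cycle zs" "v \<notin> set zs"
    and long: "\<And>ys. cycle ys \<Longrightarrow> set ys \<subseteq> insert v (set zs) \<Longrightarrow> length ys \<le> length zs"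
  defines "d \<equiv> card (nbrs (set zs) v)"
  shows "2 * ecount (set zs) + d * (d - 1) \<le> length zs * (length zs - 1)"
proof -
  define c where "c = length zs"
  define C where "C = set zs"
  define I where "I = {i. i < length zs \<and> adj v (zs ! i)}"
  define T where "T = (\<lambda>i. zs ! (Suc i mod c)) ` I"
  have c3: "3 \<le> c" using zs by (simp add: cycle_def c_def)
  have mod_lt: "t mod c < c" for t using c3 by (intro mod_less_divisor) linarith
  have dist: "distinct zs" using zs by (simp add: cycle_distinct)
  have finI: "finite I" by (simp add: I_def)
  have dI: "d \<le> card I" unfolding d_def I_def by (rule nbrs_card_le_positions) auto
  have "inj_on (\<lambda>i. zs ! (Suc i mod c)) I"
  proof (rule inj_onI)
    fix i j assume ij: "i \<in> I" "j \<in> I" "zs ! (Suc i mod c) = zs ! (Suc j mod c)"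
    have "Suc i mod c < length zs" "Suc j mod c < length zs" using mod_lt by (simp_all add: c_def)
    then have "Suc i mod c = Suc j mod c" using ij(3) dist nth_eq_iff_index_eq by blast
    then show "i = j" using mod_add_right_inj[of i 1 c j] ij by (auto simp: I_def c_def)
  qed
  then have cardT: "card T = card I" unfolding T_def by (rule card_image)
  have TC: "T \<subseteq> C" using mod_lt unfolding T_def C_def c_def by (auto intro!: nth_mem)
  have indep: "\<not> adj (zs ! (Suc i mod c)) (zs ! (Suc j mod c))" if ij: "i \<in> I" "j \<in> I" "i < j" for i j
  proof
    assume e: "adj (zs ! (Suc i mod c)) (zs ! (Suc j mod c))"
    have lt: "i < c" "j < c" "adj v (zs ! i)" "adj v (zs ! j)" using ij by (auto simp: I_def c_def)
    define k where "k = j - i"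
    define ws where "ws = rotate i zs"
    have ws: "cycle ws" "length ws = c" "set ws = C" using zs cycle_rotate by (auto simp: ws_def c_def C_def)
    have nth: "ws ! t = zs ! ((i + t) mod c)" if "t < c" for t
      using that unfolding ws_def c_def by (simp add: nth_rotate)
    obtain w us where w: "ws = w # us" using ws(2) c3 by (cases ws) auto
    have w0: "w = zs ! i" using nth[of 0] c3 lt w by simp
    have k: "0 < k" "k < c" "(i + k) mod c = j" using ij(3) lt by (auto simp: k_def)
    have lus: "length us = c - 1" using ws(2) w by simp
    have wsk: "ws ! k = zs ! j" using nth[OF k(2)] k(3) by simp
    show False
    \<comment> \<open>here the second neighbour directly precedes the first on the cycle, and \<open>v\<close> fits between them\<close>
    proof (cases "k = c - 1")
      case True
      have "ws \<noteq> []" using w by simp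
      then have "last ws = ws ! (c - 1)" using last_conv_nth[of ws] ws(2) by simp
      then have "last ws = zs ! j" using wsk True by simp
      then have "cycle (v # ws)"
        using ws zs(2) w w0 lt unfolding cycle_def path_Cons C_def by (auto simp: adj_commute)
      then show False using long[of "v # ws"] ws unfolding c_def C_def by auto
    next
      case False
      define A where "A = take k us"
      define B where "B = drop k us"
      have kc: "k < c - 1" using False k by simp
      have us: "us = A @ B" by (simp add: A_def B_def)
      have ne: "A \<noteq> []" "B \<noteq> []" using kc k lus by (auto simp: A_def B_def)
      have "last A = us ! (k - 1)"
      proof -
        have "last A = A ! (k - 1)" using ne kc lus by (simp add: last_conv_nth A_def)
        then show ?thesis using k by (simp add: A_def)
      qed
      also have "\<dots> = ws ! k" using k w by (cases k) auto
      finally have lA: "last A = zs ! j" using wsk by simp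
      have hA: "hd A = zs ! (Suc i mod c)"
      proof -
        have "hd A = us ! 0" using ne k lus kc by (simp add: A_def hd_take hd_conv_nth)
        then show ?thesis using nth[of 1] w c3 by simp
      qed
      have hB: "hd B = zs ! (Suc j mod c)"
      proof -
        have "hd B = ws ! Suc k" using kc lus w by (simp add: B_def hd_drop_conv_nth)
        moreover have "(i + Suc k) mod c = Suc j mod c" using ij(3) by (simp add: k_def)
        ultimately show ?thesis using nth[of "Suc k"] kc by simp
      qed
      have "cycle (v # w # rev B @ A)"
        using ws zs(2) ne w0 lt lA hA hB e w us by (intro cycle_crossing) (auto simp: C_def)
      moreover have "set (v # w # rev B @ A) \<subseteq> insert v C" using ws(3) w us by auto
      moreover have "length (v # w # rev B @ A) = Suc c" using ws(2) w us by simp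
      ultimately show False using long unfolding c_def C_def by fastforce
    qed
  qed
  define F where "F = {e. e \<subseteq> T \<and> card e = 2}"
  have finT: "finite T" using finI by (simp add: T_def)
  have "F \<inter> E = {}"
  proof (rule ccontr)
    assume "F \<inter> E \<noteq> {}"
    then obtain e where e: "e \<subseteq> T" "e \<in> E" by (auto simp: F_def)
    then obtain s t where st: "e = {s, t}" "s \<noteq> t" "adj s t" using edgeE by blast
    then obtain i j where ij: "i \<in> I" "j \<in> I" "s = zs ! (Suc i mod c)" "t = zs ! (Suc j mod c)"
      using e by (auto simp: T_def)
    then have "i < j \<or> j < i" using st by (metis linorder_neqE_nat)
    then show False using indep[of i j] indep[of j i] ij st adj_sym by blast
  qed
  moreover have "F \<subseteq> {e. e \<subseteq> C \<and> card e = 2}" using TC by (auto simp: F_def)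
  moreover have "finite F" using finT by (simp add: F_def)
  ultimately have "2 * ecount C + 2 * card F \<le> card C * (card C - 1)"
    by (intro ecount_missing) (auto simp: C_def)
  moreover have "2 * card F = card I * (card I - 1)"
  proof -
    have "card F = card T choose 2" unfolding F_def by (rule n_subsets[OF finT])
    then show ?thesis unfolding cardT choose_two by (cases "card I") auto
  qed
  moreover have "d * (d - 1) \<le> card I * (card I - 1)" using dI by (intro mult_le_mono diff_le_mono)
  moreover have "card C = c" using zs(1) by (simp add: C_def c_def cycle_card)
  ultimately show ?thesis unfolding C_def c_def by simp
qed

text \<open>In a cycle that misses fewer than \<open>s\<^sup>2\<close> chords, any two vertices \<open>x\<close> and \<open>y\<close> are joined by a
  path through all but at most \<open>2 s\<close> vertices. If both arcs between them are longer than \<open>s\<close>, some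
  chord joins the last \<open>s\<close> vertices of one arc (near \<open>y\<close>) to the first \<open>s\<close> vertices of the other
  (near \<open>x\<close>). Following the first arc, then the chord, then the second arc reaches \<open>y\<close>.\<close>

lemma almost_spanning_path:
  assumes zs: "cycle zs" "x \<in> set zs" "y \<in> set zs" "x \<noteq> y"
    and dense: "length zs * (length zs - 1) < 2 * ecount (set zs) + 2 * (s * s)"
  obtains us where "path (x # us @ [y])" "set us \<subseteq> set zs - {x, y}" "length zs \<le> length us + 2 + 2 * s"
proof -
  obtain us vs where uv: "path (x # us @ [y])" "path (x # vs @ [y])"
    "set us \<inter> set vs = {}" "set us \<union> set vs = set zs - {x, y}"
    "length zs = length us + length vs + 2"
    by (rule cycle_arcs[OF zs])
  consider "length us \<le> s" | "length vs \<le> s" | "s < length us" "s < length vs" by linarith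
  then show ?thesis
  proof cases
    case 1
    then show ?thesis using uv by (intro that[of vs]) auto
  next
    case 2
    then show ?thesis using uv by (intro that[of us]) auto
  next
    case 3
    define A where "A = drop (length us - s) us"
    define B where "B = take s vs"
    have len: "length A = s" "length B = s" using 3 by (auto simp: A_def B_def)
    have us: "us = take (length us - s) us @ A" by (simp add: A_def)
    have vs: "vs = B @ drop s vs" by (simp add: B_def)
    have AB: "set A \<subseteq> set us" "set B \<subseteq> set vs" by (auto simp: A_def B_def dest: in_set_dropD in_set_takeD)
    have AB_dis: "a \<noteq> b" if "a \<in> set A" "b \<in> set B" for a b using AB uv(3) that by blast
    have dis: "distinct A" "distinct B"
      using uv(1,2) by (auto simp: A_def B_def path_def)
    have "\<exists>a\<in>set A. \<exists>b\<in>set B. adj a b"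
    proof (rule ccontr)
      assume no: "\<not> ?thesis"
      define F where "F = (\<lambda>(a, b). {a, b}) ` (set A \<times> set B)"
      have "inj_on (\<lambda>(a, b). {a, b}) (set A \<times> set B)"
        using AB uv(3) by (auto simp: inj_on_def doubleton_eq_iff)
      then have "card F = s * s" unfolding F_def
        by (simp add: card_image card_cartesian_product distinct_card dis len)
      moreover have "F \<subseteq> {e. e \<subseteq> set zs \<and> card e = 2}"
        using AB AB_dis uv(3,4) by (auto simp: F_def card_insert_if)
      moreover have "F \<inter> E = {}" using no by (auto simp: F_def adj_def)
      moreover have "finite F" by (simp add: F_def)
      ultimately have "2 * ecount (set zs) + 2 * (s * s) \<le> card (set zs) * (card (set zs) - 1)"
        using ecount_missing[of "set zs" F] by simp
      then show False using dense zs(1) by (simp add: cycle_card)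
    qed
    then obtain a b where ab: "a \<in> set A" "b \<in> set B" "adj a b" by blast
    obtain A1 A2 where A: "A = A1 @ a # A2" using ab(1) by (meson split_list)
    obtain B1 B2 where B: "B = B1 @ b # B2" using ab(2) by (meson split_list)
    define U where "U = take (length us - s) us"
    define V where "V = drop s vs"
    have us': "us = U @ A1 @ a # A2" using us A by (simp add: U_def)
    have vs': "vs = B1 @ b # B2 @ V" using vs B by (simp add: V_def)
    have "path ((x # U @ A1 @ [a]) @ A2 @ [y])" using uv(1) by (simp add: us')
    then have p1: "path (x # U @ A1 @ [a])" using path_append by blast
    have "path ((x # B1) @ b # B2 @ V @ [y])" using uv(2) by (simp add: vs')
    then have p2: "path (b # B2 @ V @ [y])" using path_append by blast
    have "set (x # U @ A1 @ [a]) \<inter> set (b # B2 @ V @ [y]) = {}"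
    proof -
      have "set (U @ A1 @ [a]) \<subseteq> set us" "set (b # B2 @ V) \<subseteq> set vs" by (auto simp: us' vs')
      moreover have "y \<notin> set us" "x \<notin> set vs" using uv(4) by auto
      ultimately show ?thesis using uv(3) zs(4) by auto
    qed
    then have "path ((x # U @ A1 @ [a]) @ b # B2 @ V @ [y])"
      using p1 p2 ab(3) unfolding path_append[of "x # U @ A1 @ [a]"] by simp
    then have "path (x # (U @ A1 @ a # b # B2 @ V) @ [y])" by simp
    moreover have "set (U @ A1 @ a # b # B2 @ V) \<subseteq> set zs - {x, y}"
      using uv(4) unfolding us' vs' by auto
    moreover have "length zs \<le> length (U @ A1 @ a # b # B2 @ V) + 2 + 2 * s"
      using uv(5) 3 by (simp add: U_def V_def)
    ultimately show ?thesis by (rule that)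
  qed
qed

lemma linked_cycle:
  assumes P: "path P" "P \<noteq> []" and Q: "path Q" "Q \<noteq> []" and PQ: "set P \<inter> set Q = {}"
    and us: "path (last P # us @ [last Q])" and vs: "path (hd P # vs @ [hd Q])"
    and dis: "set us \<inter> set vs = {}" "(set us \<union> set vs) \<inter> (set P \<union> set Q) = {}"
    and len: "3 \<le> length P + length Q + length us + length vs"
  shows "cycle (P @ us @ rev Q @ rev vs)"
proof -
  have u: "path us" "us = [] \<Longrightarrow> adj (last P) (last Q)" "us \<noteq> [] \<Longrightarrow> adj (last P) (hd us)"
      "us \<noteq> [] \<Longrightarrow> adj (last us) (last Q)"
    using us unfolding path_Cons path_append by (auto split: if_splits)
  have v: "path vs" "vs = [] \<Longrightarrow> adj (hd P) (hd Q)" "vs \<noteq> [] \<Longrightarrow> adj (hd P) (hd vs)"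
      "vs \<noteq> [] \<Longrightarrow> adj (last vs) (hd Q)"
    using vs unfolding path_Cons path_append by (auto split: if_splits)
  have "path (P @ us)" using P u dis unfolding path_append by auto
  moreover have "path (vs @ Q)" using Q v dis unfolding path_append by auto
  moreover have "set (P @ us) \<inter> set (vs @ Q) = {}" using PQ dis by auto
  moreover have "adj (last (P @ us)) (last (vs @ Q))" using u P Q by (cases "us = []") auto
  ultimately have "path ((P @ us) @ rev (vs @ Q))"
    unfolding path_append[of "P @ us"] path_rev using P Q by (auto simp: hd_rev simp del: rev_append)
  moreover have "adj (hd (vs @ Q)) (hd (P @ us))" using v P Q by (cases "vs = []") (auto simp: adj_commute)
  then have "adj (last ((P @ us) @ rev (vs @ Q))) (hd ((P @ us) @ rev (vs @ Q)))"
    using P Q by (simp add: last_rev del: rev_append)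
  ultimately have "cycle ((P @ us) @ rev (vs @ Q))" using len unfolding cycle_def by simp
  then show ?thesis by simp
qed

lemma ecount_split:
  assumes "finite R" "C \<inter> R = {}"
  shows "ecount (C \<union> R) \<le> ecount C + ecount R + (\<Sum>v\<in>R. card (nbrs C v))"
  using assms
proof (induction R rule: finite_induct)
  case (insert v R)
  have "ecount (C \<union> insert v R) = ecount (C \<union> R) + card (nbrs (C \<union> insert v R) v)"
    using ecount_remove[of v "C \<union> insert v R"] insert by (simp add: Un_insert_right Diff_insert_absorb)
  moreover have "nbrs (C \<union> insert v R) v = nbrs C v \<union> nbrs (insert v R) v" by (auto simp: nbrs_def)
  then have "card (nbrs (C \<union> insert v R) v) \<le> card (nbrs C v) + card (nbrs (insert v R) v)"
    by (simp add: card_Un_le)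
  moreover have "ecount (insert v R) = ecount R + card (nbrs (insert v R) v)"
    using ecount_remove[of v "insert v R"] insert.hyps by simp
  ultimately show ?case using insert by simp
qed simp

text \<open>Here \<open>m\<close> counts the edges inside the vertex set of a cycle of length \<open>c\<close>, and \<open>e\<close> all edges.
  The conclusion bounds twice the number of nonadjacent pairs on the cycle.\<close>

lemma missing_edges_bound:
  fixes n c e m \<gamma> :: real
  assumes "n\<^sup>2 / 4 < e" "2 * e \<le> 2 * m + c * (n - c)" "c < (1 / 2 + \<gamma>) * n" "0 \<le> c" "0 < n"
  shows "c * (c - 1) - 2 * m < \<gamma> * n\<^sup>2"
proof -
  have "c * n \<le> (1 / 2 + \<gamma>) * n * n" using assms by (intro mult_right_mono) auto
  then show ?thesis using assms by (simp add: algebra_simps power2_eq_square)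
qed

text \<open>Let \<open>c\<close> be the length of the cycle and \<open>x\<close> the size of \<open>X\<close>. The bounds on \<open>c\<close> force \<open>\<gamma> n > 1/2\<close>, hence \<open>n > 50000\<close>, so additive constants are negligible
  against \<open>n\<close>. The factor 7 is made of \<open>6 \<gamma> n\<close>, from \<open>x \<ge> n/6\<close> and
  \<open>x (c - 1 - x) < \<gamma> n\<^sup>2\<close>, and of \<open>\<gamma> n > 1/2\<close>, which absorbs the
  difference between \<open>c - 1 > (n - 1)/2\<close> and \<open>n/2\<close>.\<close>

lemma barely_long_circumference_structure:
  fixes \<gamma> :: real
  assumes fin: "finite S" and n: "n = card S" and dense: "(real n)\<^sup>2 / 4 < real (ecount S)"
    and \<gamma>: "0 < \<gamma>" "\<gamma> < 1 / 10 ^ 5"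
    and zs: "cycle zs" "set zs \<subseteq> S"
    and long: "\<And>ys. cycle ys \<Longrightarrow> set ys \<subseteq> S \<Longrightarrow> length ys \<le> length zs"
    and c_low: "n + 1 < 2 * length zs" and c_up: "real (length zs) < (1 / 2 + \<gamma>) * real n"
  shows "\<exists>w X. w \<in> S \<and> X \<subseteq> S - {w} \<and> (\<forall>u\<in>X. \<forall>v\<in>S - X - {w}. \<not> adj u v) \<and>
    2 * card X + 1 < n \<and> (1 / 2 - 7 * \<gamma>) * real n < real (card X)"
proof -
  define C where "C = set zs"
  define R where "R = S - C"
  define c where "c = length zs"
  have cardC: "card C = c" and c3: "3 \<le> c" using zs by (auto simp: C_def c_def cycle_card cycle_def)
  have CS: "C \<subseteq> S" "finite C" "finite R" "S = C \<union> R" "C \<inter> R = {}"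
    using zs fin by (auto simp: C_def R_def)
  have nr: "n = c + card R" using CS cardC n by (simp add: card_Un_disjoint)
  have cl: "real n + 1 < 2 * real c" using c_low unfolding c_def by linarith
  have cu: "real c < (1 / 2 + \<gamma>) * real n" using c_up by (simp add: c_def)
  have \<gamma>n: "1 / 2 < \<gamma> * real n" using cl cu by (simp add: algebra_simps)
  have n_big: "50000 < real n"
  proof (rule ccontr)
    assume "\<not> ?thesis"
    then have "\<gamma> * real n \<le> (1 / 10 ^ 5) * 50000" using \<gamma> by (intro mult_mono) auto
    then show False using \<gamma>n by simp
  qed
  have n0: "0 < real n" using n_big by simp
  have \<gamma>n_up: "\<gamma> * real n \<le> real n / 10 ^ 5" 
    using mult_right_mono[of \<gamma> "1 / 10 ^ 5" "real n"] \<gamma> n0 by simp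
  have \<gamma>nn: "\<gamma> * (real n)\<^sup>2 \<le> (real n)\<^sup>2 / 10 ^ 5"
    using mult_right_mono[OF \<gamma>n_up, of "real n"] n0 by (simp add: power2_eq_square field_simps)
  have cu': "real c < 50001 / 100000 * real n" using cu \<gamma>n_up by (simp add: algebra_simps)
  \<comment> \<open>fewer than \<open>\<gamma> n\<^sup>2/2\<close> pairs on \<open>C\<close> are nonadjacent, since at most \<open>c (n - c)/2\<close> edges are not inside \<open>C\<close>\<close>
  have miss: "real c * (real c - 1) - 2 * real (ecount C) < \<gamma> * (real n)\<^sup>2"
  proof (rule missing_edges_bound[OF dense])
    have "2 * ecount S \<le> 2 * ecount C + c * (n - c)"
      using edges_off_longest_cycle[OF fin zs long] unfolding C_def c_def n by blast
    then have "real (2 * ecount S) \<le> real (2 * ecount C + c * (n - c))" by (rule of_nat_mono)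
    then show "2 * real (ecount S) \<le> 2 * real (ecount C) + real c * (real n - real c)"
      using nr by (simp add: of_nat_diff)
  qed (use cu n0 in auto)
  have c1: "real (c - 1) = real c - 1" using c3 by (simp add: of_nat_diff)
  \<comment> \<open>\<open>n/100\<close> neighbours would cost about \<open>n\<^sup>2/20000\<close> edges inside \<open>C\<close>, and only \<open>n\<^sup>2/200000\<close> can be missing\<close>
  have deg: "real (card (nbrs C v)) \<le> real n / 100" if v: "v \<in> R" for v
  proof (rule ccontr)
    define d where "d = card (nbrs C v)"
    assume "\<not> ?thesis"
    then have d: "real n / 100 < real d" by (simp add: d_def)
    have "2 * ecount C + d * (d - 1) \<le> c * (c - 1)"
      unfolding C_def d_def c_def
    proof (rule off_cycle_degree_bound[OF zs(1)])
      show "v \<notin> set zs" using v by (auto simp: R_def C_def)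
      show "length ys \<le> length zs" if "cycle ys" "set ys \<subseteq> insert v (set zs)" for ys
        using that long zs(2) v by (auto simp: R_def C_def)
    qed
    then have "real (2 * ecount C + d * (d - 1)) \<le> real (c * (c - 1))" by (rule of_nat_mono)
    moreover have "1 \<le> d" using d n_big by (cases d) auto
    ultimately have "real d * (real d - 1) < \<gamma> * (real n)\<^sup>2" using miss c1 by (simp add: of_nat_diff)
    moreover have "real n / 100 * (real n / 200) \<le> real d * (real d - 1)"
      using d n_big by (intro mult_mono) auto
    moreover have "(real n)\<^sup>2 / 10 ^ 5 < real n / 100 * (real n / 200)"
      using n0 by (simp add: power2_eq_square)
    ultimately show False using \<gamma>nn by linarith
  qed
  \<comment> \<open>\<open>C\<close> takes about \<open>n\<^sup>2/8\<close> of the \<open>n\<^sup>2/4\<close> edges, and the edges between \<open>C\<close> and \<open>R\<close> at most \<open>n\<^sup>2/200\<close>\<close>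
  have eR: "11 / 100 * (real n)\<^sup>2 < real (ecount R)"
  proof -
    have "ecount S \<le> ecount C + ecount R + (\<Sum>v\<in>R. card (nbrs C v))"
      using ecount_split[OF CS(3,5)] CS(4) by simp
    then have "real (ecount S) \<le> real (ecount C) + real (ecount R) + (\<Sum>v\<in>R. real (card (nbrs C v)))"
      using of_nat_mono[where 'a = real] by fastforce
    also have "(\<Sum>v\<in>R. real (card (nbrs C v))) \<le> real (card R) * (real n / 100)"
      using sum_bounded_above[of R "\<lambda>v. real (card (nbrs C v))" "real n / 100"] deg by simp
    also have "\<dots> \<le> real n / 2 * (real n / 100)"
      using nr cl by (intro mult_right_mono) auto
    finally have 1: "real (ecount S) \<le> real (ecount C) + real (ecount R) + real n / 2 * (real n / 100)"
      by simp
    have "2 * ecount C \<le> c * (c - 1)" using ecount_le[OF CS(2)] cardC by simp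
    then have "real (2 * ecount C) \<le> real (c * (c - 1))" by (rule of_nat_mono)
    then have "2 * real (ecount C) \<le> real c * (real c - 1)" using c1 by simp
    also have "\<dots> \<le> real c * real c" by (intro mult_left_mono) auto
    also have "\<dots> \<le> (50001 / 100000 * real n) * (50001 / 100000 * real n)"
      using cu' by (intro mult_mono) auto
    finally have 2: "2 * real (ecount C) \<le> (50001 / 100000 * real n) * (50001 / 100000 * real n)" .
    have "0 < real n * real n" using n0 by simp
    then show ?thesis using 1 2 dense unfolding power2_eq_square by (simp add: field_simps)
  qed
  have rr: "real (card R) \<le> real n / 2" using nr cl by linarith
  have Rne: "R \<noteq> {}" using eR ecount_le[OF CS(3)] n0 by (cases "R = {}") auto
  obtain ys where ys: "cycle ys" "set ys \<subseteq> R" "real n / 5 \<le> real (length ys)"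
  proof (rule ccontr)
    assume "\<not> thesis"
    then have no: "real (length ys) < real n / 5" if "cycle ys" "set ys \<subseteq> R" for ys
      using \<open>\<And>ys. cycle ys \<Longrightarrow> set ys \<subseteq> R \<Longrightarrow> real n / 5 \<le> real (length ys) \<Longrightarrow> thesis\<close> that
      by (meson not_le)
    define b where "b = nat \<lfloor>real n / 5\<rfloor>"
    have b: "real b \<le> real n / 5" "real n / 5 < real b + 1" unfolding b_def using n0 by linarith+
    have "2 * ecount R \<le> b * (card R - 1)"
    proof (rule circumference_edge_bound[OF CS(3) Rne])
      show "2 \<le> b" using b n_big by linarith
      show "length xs \<le> b" if "cycle xs" "set xs \<subseteq> R" for xs
        using no[OF that] b by linarith
    qed
    also have "\<dots> \<le> b * card R" by simp
    finally have "real (2 * ecount R) \<le> real (b * card R)" by (rule of_nat_mono)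
    then have "2 * real (ecount R) \<le> real b * real (card R)" by simp
    also have "\<dots> \<le> real n / 5 * (real n / 2)" using b rr by (intro mult_mono) auto
    finally show False using eR n0 by (simp add: power2_eq_square)
  qed
  have ysS: "set ys \<subseteq> S" "set ys \<inter> C = {}" using ys(2) by (auto simp: R_def)
  define D where "D = {(u, v) \<in> S \<times> S. adj u v}"
  have finD: "finite D" using fin by (intro finite_subset[of D "S \<times> S"]) (auto simp: D_def)
  from finD show ?thesis
  proof (cases rule: menger_two[of D "set ys" C])
    case (paths P Q)
    have pth: "path T" "T \<noteq> []" "2 \<le> length T" "set T \<subseteq> S" "hd T \<in> set ys" "last T \<in> C"
      if T: "linking D (set ys) C T" for T
    proof -
      have T': "T \<noteq> []" "distinct T" "steps D T" "hd T \<in> set ys" "last T \<in> C"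
        using T by (auto simp: linking_def)
      then show "T \<noteq> []" "hd T \<in> set ys" "last T \<in> C" by auto
      have "successively adj T" using T'(3) by (rule successively_mono) (auto simp: D_def)
      then show "path T" using T' by (simp add: path_def)
      have "hd T \<noteq> last T" using T' ysS by auto
      then show "2 \<le> length T" using T'(1) by (cases T; cases "tl T") auto
      have "set T \<subseteq> insert (hd T) (Range D)" using T'(3)
        by (induction T rule: induct_list012) auto
      then show "set T \<subseteq> S" using T' ysS by (auto simp: D_def)
    qed
    note P = pth[OF paths(1)] and Q = pth[OF paths(2)]
    have ends: "hd P \<noteq> hd Q" "last P \<noteq> last Q"
      using paths(3) P(2) Q(2) by (metis disjoint_iff hd_in_set, metis disjoint_iff last_in_set)
    define s where "s = nat \<lceil>real n / 100\<rceil>"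
    have s: "real n / 100 \<le> real s" "real s < real n / 100 + 1" unfolding s_def using n0 by linarith+
    obtain us where us: "path (last P # us @ [last Q])" "set us \<subseteq> C - {last P, last Q}"
        "c \<le> length us + 2 + 2 * s"
    proof (rule almost_spanning_path[OF zs(1), of "last P" "last Q" s])
      show "last P \<in> set zs" "last Q \<in> set zs" "last P \<noteq> last Q" using P Q ends by (auto simp: C_def)
      have "real n / 100 * (real n / 100) \<le> real s * real s" using s n0 by (intro mult_mono) auto
      moreover have "(real n)\<^sup>2 / 10 ^ 5 \<le> 2 * (real n / 100 * (real n / 100))"
        by (simp add: power2_eq_square)
      ultimately have "real c * (real c - 1) < 2 * real (ecount C) + 2 * (real s * real s)"
        using miss \<gamma>nn by linarith
      then have "real (c * (c - 1)) < real (2 * ecount C + 2 * (s * s))" using c1 by simp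
      then show "length zs * (length zs - 1) < 2 * ecount (set zs) + 2 * (s * s)"
        unfolding c_def C_def by (simp only: of_nat_less_iff)
    qed (auto simp: C_def c_def)
    obtain vs where vs: "path (hd P # vs @ [hd Q])" "set vs \<subseteq> set ys - {hd P, hd Q}"
        "length ys \<le> 2 * length vs + 2"
      using cycle_long_arc[OF ys(1) P(5) Q(5) ends(1)] .
    \<comment> \<open>\<open>us\<close> misses about \<open>n/50\<close> vertices of \<open>C\<close>, while half of the second cycle contributes about \<open>n/10\<close>, so this cycle is longer than \<open>C\<close>\<close>
    have "cycle (P @ us @ rev Q @ rev vs)"
    proof (rule linked_cycle[OF P(1,2) Q(1,2) paths(3) us(1) vs(1)])
      show "set us \<inter> set vs = {}" using us vs ysS by auto
      show "(set us \<union> set vs) \<inter> (set P \<union> set Q) = {}" using us(2) vs(2) paths(4-7) by blast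
    qed (use P(3) Q(3) in linarith)
    moreover have "set (P @ us @ rev Q @ rev vs) \<subseteq> S"
      using P(4) Q(4) us(2) vs(2) CS(1) ysS(1) by auto
    ultimately have "length (P @ us @ rev Q @ rev vs) \<le> c" using long unfolding c_def by blast
    then have "4 + length us + length vs \<le> c" using P(3) Q(3) by simp
    then have "real (4 + length us + length vs) \<le> real c" by (rule of_nat_mono)
    moreover have "real c \<le> real (length us + 2 + 2 * s)" using us(3) by (rule of_nat_mono)
    moreover have "real (length ys) \<le> real (2 * length vs + 2)" using vs(3) by (rule of_nat_mono)
    ultimately show ?thesis using s(2) ys(3) n_big by simp
  next
    case (separator w0 X)
    define w where "w = (if w0 \<in> S then w0 else hd zs)"
    have zC: "hd zs \<in> C" using c3 unfolding C_def c_def by (intro hd_in_set) auto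
    have XS: "X \<subseteq> S" using separator(4) ysS by (auto simp: D_def)
    have wS: "w \<in> S" and wX: "w \<notin> X" using zC CS(1) separator(1,3) by (auto simp: w_def)
    have closed: "\<not> adj u v" if "u \<in> X" "v \<in> S - X - {w}" for u v
      using separator(5)[of u v] that XS by (auto simp: D_def w_def split: if_splits)
    define x where "x = card X"
    have finX: "finite X" using XS fin finite_subset by blast
    have "X \<subseteq> R" using XS separator(3) by (auto simp: R_def)
    then have "x \<le> card R" unfolding x_def by (rule card_mono[OF CS(3)])
    then have x_up: "2 * x + 1 < n" using nr c_low unfolding c_def by linarith
    have "length ys \<le> x + 1"
    proof -
      have "set ys \<subseteq> insert w0 X" using separator(2) .
      then have "card (set ys) \<le> card (insert w0 X)" using finX by (intro card_mono) auto
      then show ?thesis using separator(1) finX ys(1) by (simp add: cycle_card x_def)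
    qed
    then have "real (length ys) \<le> real (x + 1)" by (rule of_nat_mono)
    then have x_low: "real n / 6 \<le> real x" using ys(3) n_big by simp
    have sep: "separation S (insert w X) (S - X) w"
    proof -
      have "X \<noteq> {}" using x_low n0 by (auto simp: x_def)
      moreover have "S - X \<noteq> {w}"
      proof
        assume "S - X = {w}"
        then have "C \<subseteq> {w}" using CS(1) separator(3) by blast
        then show False using cardC c3 card_mono[of "{w}" C] by simp
      qed
      ultimately show ?thesis using XS wS wX closed unfolding separation_def by auto
    qed
    \<comment> \<open>the side \<open>X\<close> is bounded as if complete, the side of \<open>C\<close> through its circumference\<close>
    have "2 * ecount (insert w X) \<le> (x + 1) * x"
      using ecount_le[of "insert w X"] finX wX by (simp add: x_def)
    moreover have "2 * ecount (S - X) \<le> c * (n - x - 1)"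
    proof -
      have "2 * ecount (S - X) \<le> c * (card (S - X) - 1)"
        using fin wS wX c3 long unfolding c_def by (intro circumference_edge_bound) auto
      then show ?thesis using XS finX by (simp add: card_Diff_subset n x_def)
    qed
    ultimately have "2 * ecount S \<le> (x + 1) * x + c * (n - x - 1)"
      using separation_ecount[OF sep] by linarith
    then have "real (2 * ecount S) \<le> real ((x + 1) * x + c * (n - x - 1))" by (rule of_nat_mono)
    then have "2 * real (ecount S) \<le> (real x + 1) * real x + real c * real (n - x - 1)"
      by (simp only: of_nat_mult of_nat_add of_nat_1 of_nat_numeral)
    moreover have "real (n - x - 1) = real n - real x - 1" using x_up by linarith
    ultimately have e: "2 * real (ecount S) \<le> (real x + 1) * real x + real c * (real n - real x - 1)"
      by (simp only:)
    have "real c * real n \<le> (1 / 2 + \<gamma>) * real n * real n" using cu by (intro mult_right_mono) auto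
    then have prod: "real x * (real c - 1 - real x) < \<gamma> * (real n)\<^sup>2"
      using e dense c3 by (simp add: algebra_simps power2_eq_square)
    have "real c - 1 - real x < 6 * \<gamma> * real n"
    proof (rule ccontr)
      assume "\<not> ?thesis"
      then have "real n / 6 * (6 * \<gamma> * real n) \<le> real x * (real c - 1 - real x)"
        using x_low n0 \<gamma> by (intro mult_mono) auto
      then show False using prod by (simp add: power2_eq_square mult.commute mult.left_commute)
    qed
    then have "(1 / 2 - 7 * \<gamma>) * real n < real x" using cl \<gamma>n by (simp add: algebra_simps)
    then show ?thesis using wS wX XS closed x_up unfolding x_def by (intro exI[of _ w] exI[of _ X]) auto
  qed
qed

end

section \<open>Cycle copies and the dichotomy\<close>

lemma contains_cycle_graph:
  assumes G: "simple_graph G" and E: "finite_edges (edges G)"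
    and xs: "finite_edges.cycle (edges G) xs" "set xs \<subseteq> verts G"
  shows "contains_copy G (cycle_graph (length xs))"
proof -
  interpret finite_edges "edges G" by (rule E)
  define t where "t = length xs"
  have t3: "3 \<le> t" and dist: "distinct xs" using xs by (auto simp: t_def cycle_def path_def)
  define H where "H = \<lparr>verts = set xs, edges = (\<lambda>e. (!) xs ` e) ` edges (cycle_graph t)\<rparr>"
  have H_adj: "adj (xs ! i) (xs ! (Suc i mod t))" if "i < t" for i
  proof (cases "Suc i = t")
    case True
    then have "xs ! i = last xs" using t3 unfolding t_def by (metis diff_Suc_1 last_conv_nth list.size(3) not_numeral_le_zero)
    moreover have "xs ! 0 = hd xs" using t3 unfolding t_def by (metis hd_conv_nth list.size(3) not_numeral_le_zero)
    ultimately show ?thesis using True xs(1) by (simp add: cycle_def)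
  next
    case False
    then show ?thesis using that xs(1) unfolding cycle_def path_def t_def
      by (auto simp: successively_conv_nth)
  qed
  have "edges H \<subseteq> edges G"
    using H_adj by (auto simp: H_def cycle_graph_def adj_def)
  moreover have "e \<subseteq> set xs" if "e \<in> edges H" for e
    using that t3 unfolding H_def cycle_graph_def t_def by (auto intro!: nth_mem mod_less_divisor)
  ultimately have "subgraph H G"
    using G xs(2) unfolding subgraph_def simple_graph_def by (auto simp: H_def)
  moreover have "isomorphic (cycle_graph t) H"
    unfolding isomorphic_def
    by (rule exI[of _ "(!) xs"]) (use bij_betw_nth[OF dist, of "{..<t}" "set xs"] in
      \<open>auto simp: H_def t_def cycle_graph_def\<close>)
  ultimately show ?thesis unfolding contains_copy_def t_def by blast
qed

theorem theorem1:
  fixes \<gamma> :: real and G :: "'a graph" and n :: nat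
  assumes "0 < \<gamma>" and "\<gamma> < 1 / 10 ^ 5"
    and "simple_graph G"
    and "graph_order G = n"
    and "real (edge_count G) > real n ^ 2 / 4"
  shows
    "(\<forall>t::nat. 3 \<le> t \<and> int t \<le> \<lceil>(1 / 2 + \<gamma>) * real n\<rceil> \<longrightarrow> contains_copy G (cycle_graph t))
     \<or>
     (\<exists>v\<in>verts G. \<exists>H1 H2 :: 'a graph.
        simple_graph H1 \<and> simple_graph H2 \<and> vertex_disjoint H1 H2 \<and>
        delete_vertex G v = graph_union H1 H2 \<and>
        (1 / 2 - 900 * \<gamma>) * real n < real (graph_order H1) \<and>
        graph_order H1 \<le> graph_order H2 \<and>
        real (graph_order H2) < (1 / 2 + 900 * \<gamma>) * real n)"
proof -
  define S where "S = verts G"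
  have fin: "finite S" and sub: "\<And>e. e \<in> edges G \<Longrightarrow> e \<subseteq> S \<and> card e = 2"
    using assms(3) by (auto simp: simple_graph_def S_def)
  have "edges G \<subseteq> Pow S" using sub by auto
  then have "finite (edges G)" using fin finite_subset by blast
  then have E: "finite_edges (edges G)" using sub by unfold_locales auto
  interpret finite_edges "edges G" by (rule E)
  have "{e \<in> edges G. e \<subseteq> S} = edges G" using sub by auto
  then have dense: "(real n)\<^sup>2 / 4 < real (ecount S)"
    using assms(5) unfolding ecount_def edge_count_def by simp
  have n: "n = card S" using assms(4) by (simp add: graph_order_def S_def)
  have Sne: "S \<noteq> {}"
  proof
    assume "S = {}"
    then have "2 * ecount S = 0" using ecount_le[OF fin] by simp
    then show False using dense by simp
  qed
  have n1: "1 \<le> n" using Sne fin n by (simp add: Suc_leI card_gt_0_iff)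
  then have n1': "real (n - 1) = real n - 1" by (simp add: of_nat_diff)
  have circ: "real n + 1 < 2 * real b"
    if "2 \<le> b" and b: "\<And>xs. cycle xs \<Longrightarrow> set xs \<subseteq> S \<Longrightarrow> length xs \<le> b" for b
  proof (rule ccontr)
    assume "\<not> ?thesis"
    then have "2 * real b \<le> real n + 1" by simp
    then have "2 * real b * (real n - 1) \<le> (real n + 1) * (real n - 1)" using n1 by (intro mult_right_mono) auto
    moreover have "real (2 * ecount S) \<le> real (b * (n - 1))"
      using circumference_edge_bound[OF fin Sne that] unfolding n by (rule of_nat_mono)
    ultimately show False using dense n1' by (simp add: algebra_simps power2_eq_square)
  qed
  have "\<exists>xs. cycle xs \<and> set xs \<subseteq> S"
  proof (rule ccontr)
    assume no: "\<not> ?thesis"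
    then have "real n < 3" using circ[of 2] by fastforce
    then have "n \<le> 2" by simp
    moreover have "2 * ecount S \<le> n * (n - 1)" using ecount_le[OF fin] n by simp
    moreover have "n = 1 \<or> n = 2" using n1 \<open>n \<le> 2\<close> by linarith
    ultimately show False using dense by auto
  qed
  then obtain xs0 where xs0: "cycle xs0 \<and> set xs0 \<subseteq> S" by blast
  obtain zs where zs: "cycle zs \<and> set zs \<subseteq> S"
      and long: "\<And>ys. cycle ys \<and> set ys \<subseteq> S \<Longrightarrow> length ys \<le> length zs"
    by (rule longest_list_exists[of S "\<lambda>xs. cycle xs \<and> set xs \<subseteq> S" xs0])
      (use fin xs0 cycle_distinct in auto)
  define c where "c = length zs"
  have c3: "3 \<le> c" using zs by (auto simp: cycle_def c_def)
  have "real n + 1 < 2 * real c" using long c3 by (intro circ) (auto simp: c_def)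
  then have c_low: "n + 1 < 2 * c" by linarith
  \<comment> \<open>the two alternatives correspond to whether the circumference reaches the required length\<close>
  show ?thesis
  proof (cases "\<lceil>(1 / 2 + \<gamma>) * real n\<rceil> \<le> int c")
    case True
    have "contains_copy G (cycle_graph t)" if t: "3 \<le> t" "int t \<le> \<lceil>(1 / 2 + \<gamma>) * real n\<rceil>" for t
    proof -
      have "real (n * n) < real (4 * ecount S)" using dense by (simp add: power2_eq_square)
      then have "card S * card S < 4 * ecount S" unfolding n by (simp only: of_nat_less_iff)
      moreover have "t \<le> c" using t(2) True by linarith
      ultimately obtain ys where "cycle ys" "set ys \<subseteq> S" "length ys = t"
        using weakly_pancyclic[OF fin, of zs t] zs c_low t(1) n unfolding c_def by auto
      then show ?thesis using contains_cycle_graph[OF assms(3) E, of ys] by (simp add: S_def)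
    qed
    then show ?thesis by blast
  next
    case False
    then have c_up: "real c < (1 / 2 + \<gamma>) * real n" by (simp add: not_le less_ceiling_iff)
    then obtain w X where w: "w \<in> S" "X \<subseteq> S - {w}" "\<forall>u\<in>X. \<forall>v\<in>S - X - {w}. \<not> adj u v"
      and X: "2 * card X + 1 < n" "(1 / 2 - 7 * \<gamma>) * real n < real (card X)"
      using barely_long_circumference_structure[OF fin n dense assms(1,2), of zs] zs long c_low
      unfolding c_def by blast
    define Y where "Y = S - X - {w}"
    define H1 where "H1 = \<lparr>verts = X, edges = {e \<in> edges G. e \<subseteq> X}\<rparr>"
    define H2 where "H2 = \<lparr>verts = Y, edges = {e \<in> edges G. e \<subseteq> Y}\<rparr>"
    have finXY: "finite X" "finite Y" using w fin finite_subset[of X S] by (auto simp: Y_def)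
    have "card (X \<union> Y) = card X + card Y" using finXY by (intro card_Un_disjoint) (auto simp: Y_def)
    moreover have "X \<union> Y = S - {w}" using w by (auto simp: Y_def)
    ultimately have XY: "card X + card Y = n - 1" using w n by simp
    have "delete_vertex G w = graph_union H1 H2"
    proof -
      have "{e \<in> edges G. w \<notin> e} = {e \<in> edges G. e \<subseteq> X} \<union> {e \<in> edges G. e \<subseteq> Y}"
      proof (intro equalityI subsetI)
        fix e assume e: "e \<in> {e \<in> edges G. w \<notin> e}"
        then obtain u v where uv: "e = {u, v}" "adj u v" using edgeE by blast
        moreover have "e \<subseteq> X \<union> Y" using e sub \<open>X \<union> Y = S - {w}\<close> by blast
        ultimately show "e \<in> {e \<in> edges G. e \<subseteq> X} \<union> {e \<in> edges G. e \<subseteq> Y}"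
          using e w(3) adj_sym[OF uv(2)] unfolding Y_def by auto
      qed (use w in \<open>auto simp: Y_def\<close>)
      then show ?thesis using \<open>X \<union> Y = S - {w}\<close>
        by (simp add: delete_vertex_def graph_union_def H1_def H2_def S_def)
    qed
    moreover have "simple_graph H1" "simple_graph H2"
      using finXY sub by (auto simp: simple_graph_def H1_def H2_def)
    moreover have "vertex_disjoint H1 H2" by (auto simp: vertex_disjoint_def H1_def H2_def Y_def)
    moreover have "0 < \<gamma> * real n" using assms(1) n1 by simp
    then have "(1 / 2 - 900 * \<gamma>) * real n < real (card X)" "real (card Y) < (1 / 2 + 900 * \<gamma>) * real n"
      using X(2) XY n1 by (simp_all add: algebra_simps)
    moreover have "card X \<le> card Y" using X(1) XY by linarith
    ultimately show ?thesis using w(1) unfolding graph_order_def H1_def H2_def S_def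
      by (intro disjI2 bexI[of _ w] exI conjI) auto
  qed
qed

end
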